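(* Let $d\ge 1$ and let $S_n$, $n\ge 0$, be an aperiodic, transient random walk on $\mathbb{Z}^d$ which is asymptotically stable with norming sequence $c_n=(c_{n1},\ldots,c_{nd})$, and let $g$ be the density of the limit $Y$. Put $C_n=\prod_{r=1}^d c_{nr}$, let $\tau$ be the time of first return of $S_n$ to the origin, and let $p=\mathbb{P}\{\tau<\infty\}$. Then, as $n\to\infty$, $$ \mathbb{P}\{\tau=n\}\sim (1-p)^2\,\mathbb{P}\{S_n=0\}\sim \frac{(1-p)^2 g(0,\ldots,0)}{C_n}. $$
   Context: Random walk: $\xi_n=(\xi_{n1},\ldots,\xi_{nd})$, $n\ge 1$, are independent identically distributed $\mathbb{Z}^d$-valued random vectors, $S_0=0$ and $S_n=\xi_1+\cdots+\xi_n=(S_{n1},\ldots,S_{nd})$. First return time: $\tau=\min\{k>0:S_k=0\}$, with $\min\emptyset=\infty$. The walk is transient if $p=\mathbb{P}\{\tau<\infty\}<1$, equivalently $\sum_{n\ge1}\mathbb{P}\{S_n=0\}<\infty$. Aperiodic: for every $\varepsilon>0$, $\sup_{\lambda\in[-\pi,\pi]^d\setminus[-\varepsilon,\varepsilon]^d}|\mathbb{E}e^{i(\lambda,\xi_1)}|<1$ (the condition being vacuous when the index set is empty). Asymptotically stable (without centering, with possibly different norming for each component): there is a sequence $c_n=(c_{n1},\ldots,c_{nd})$ of vectors with positive components such that $$(S_{n1}/c_{n1},\ldots,S_{nd}/c_{nd})\to Y=(Y_1,\ldots,Y_d)$$ in distribution, where $Y$ is a strictly $d$-dimensional stable random variable,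 that is, a stable limit (in the sense of componentwise norming) that is genuinely $d$-dimensional, i.e. not concentrated on a proper affine subspace; $g$ denotes its (continuous) density on $\mathbb{R}^d$. Each component $Y_r$ is univariate stable with some index $\alpha_r\in(0,2]$, and $c_{nr}$ is then regularly varying in $n$ with index $1/\alpha_r$. The notation $a_n\sim b_n$ denotes asymptotic equivalence: $a_n/b_n\to1$ as $n\to\infty$.
   Formalization: The formal theorem additionally assumes g(0,…,0) ≠ 0; if g(0,…,0) = 0 (e.g. a one-sided stable limit of index 1/2 with steps ≥ −1), the last term is zero and the relation ~, a ratio tending to 1, is undefined. *)

theory Defs
  imports "HOL-Probability.Probability"
begin

unbundle asymp_equiv_syntax

definition real_vec :: "int ^ 'd \<Rightarrow> real ^ 'd" where
  "real_vec x = (\<chi> r. real_of_int (x $ r))"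

(* The steps are X 1, X 2, ...; the value X 0 plays no role. *)

definition iid_steps :: "'a measure \<Rightarrow> (nat \<Rightarrow> 'a \<Rightarrow> int ^ 'd) \<Rightarrow> bool" where
  "iid_steps M X \<longleftrightarrow>
     prob_space.indep_vars M (\<lambda>_. count_space UNIV) X {1..} \<and>
     (\<forall>n\<ge>1. distr M (count_space UNIV) (X n) = distr M (count_space UNIV) (X 1))"

definition walk :: "(nat \<Rightarrow> 'a \<Rightarrow> int ^ 'd) \<Rightarrow> nat \<Rightarrow> 'a \<Rightarrow> int ^ 'd" where
  "walk X n \<omega> = (\<Sum>k=1..n. X k \<omega>)"

(* In enat the infimum of the empty set is \<infinity>, and otherwise Inf is the minimum. *)

definition return_time :: "(nat \<Rightarrow> 'a \<Rightarrow> int ^ 'd) \<Rightarrow> 'a \<Rightarrow> enat" where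
  "return_time X \<omega> = Inf (enat ` {k. k > 0 \<and> walk X k \<omega> = 0})"

definition return_prob :: "'a measure \<Rightarrow> (nat \<Rightarrow> 'a \<Rightarrow> int ^ 'd) \<Rightarrow> real" where
  "return_prob M X = \<P>(\<omega> in M. return_time X \<omega> < \<infinity>)"

definition transient :: "'a measure \<Rightarrow> (nat \<Rightarrow> 'a \<Rightarrow> int ^ 'd) \<Rightarrow> bool" where
  "transient M X \<longleftrightarrow> return_prob M X < 1"

definition cube :: "real \<Rightarrow> (real ^ 'd) set" where
  "cube a = {t. \<forall>r. t $ r \<in> {-a..a}}"

(* The nonemptiness guard makes the condition vacuous for \<epsilon> \<ge> pi, since the
   real supremum of the empty set is a junk value. *)

definition aperiodic :: "'a measure \<Rightarrow> (nat \<Rightarrow> 'a \<Rightarrow> int ^ 'd) \<Rightarrow> bool" where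
  "aperiodic M X \<longleftrightarrow>
     (\<forall>\<epsilon>>0. cube pi - cube \<epsilon> \<noteq> ({} :: (real ^ 'd) set) \<longrightarrow>
        (SUP t \<in> cube pi - cube \<epsilon>. cmod (CLINT \<omega>|M. iexp (t \<bullet> real_vec (X 1 \<omega>)))) < 1)"

(* HOL-Probability only has weak convergence for laws on the real line. *)

definition conv_in_distribution ::
    "'a measure \<Rightarrow> (nat \<Rightarrow> 'a \<Rightarrow> real ^ 'd) \<Rightarrow> 'b measure \<Rightarrow> ('b \<Rightarrow> real ^ 'd) \<Rightarrow> bool" where
  "conv_in_distribution M Z N Y \<longleftrightarrow>
     (\<forall>f :: real ^ 'd \<Rightarrow> real. continuous_on UNIV f \<and> bounded (range f) \<longrightarrow>
        (\<lambda>n. LINT \<omega>|M. f (Z n \<omega>)) \<longlonglongrightarrow> (LINT \<omega>|N. f (Y \<omega>)))"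

(* Stability with componentwise norming: the sum of k independent copies has, for each
   k > 0, the law of (b_1 Y_1 + a_1, ..., b_d Y_d + a_d) with all b_r > 0. *)

definition stable_law :: "(real ^ 'd) measure \<Rightarrow> bool" where
  "stable_law \<nu> \<longleftrightarrow>
     (\<forall>k::nat. k > 0 \<longrightarrow> (\<exists>(a :: real ^ 'd) (b :: real ^ 'd). (\<forall>r. b $ r > 0) \<and>
        distr (PiM {..<k} (\<lambda>_. \<nu>)) borel (\<lambda>y. \<Sum>i<k. y i) =
        distr \<nu> borel (\<lambda>x. \<chi> r. b $ r * x $ r + a $ r)))"

definition full_dimensional :: "(real ^ 'd) measure \<Rightarrow> bool" where
  "full_dimensional \<nu> \<longleftrightarrow> (\<forall>A. affine A \<and> A \<noteq> UNIV \<longrightarrow> measure \<nu> A < 1)"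

definition asymptotically_stable ::
    "'a measure \<Rightarrow> (nat \<Rightarrow> 'a \<Rightarrow> int ^ 'd) \<Rightarrow> (nat \<Rightarrow> real ^ 'd) \<Rightarrow>
     'b measure \<Rightarrow> ('b \<Rightarrow> real ^ 'd) \<Rightarrow> bool" where
  "asymptotically_stable M X c N Y \<longleftrightarrow>
     (\<forall>n\<ge>1. \<forall>r. c n $ r > 0) \<and>
     conv_in_distribution M (\<lambda>n \<omega>. \<chi> r. real_vec (walk X n \<omega>) $ r / c n $ r) N Y \<and>
     stable_law (distr N borel Y) \<and>
     full_dimensional (distr N borel Y)"

end

theory Submission
  imports Defs "HOL-Real_Asymp.Real_Asymp"
begin

text \<open>
  Write \<open>u n\<close> for the probability that the walk is at the origin at time \<open>n\<close>, \<open>f n\<close> for the probability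
  that it returns there for the first time at time \<open>n\<close>, \<open>\<phi>\<close> for the characteristic function of a step,
  \<open>\<psi>\<close> for that of the limit, and \<open>C n\<close> for the product of the components of \<open>c n\<close>. There are two halves.

  Local limit. Fourier inversion on the lattice gives \<open>u n = (2 pi)^(-d) \<integral> \<phi>^n\<close> over the cube of side
  \<open>2 pi\<close>. Substituting \<open>t / c n\<close> for \<open>t\<close> turns \<open>C n * u n\<close> into an integral of \<open>\<phi> (t / c n)^n\<close>, which
  converges pointwise to \<open>\<psi> t\<close>. What makes dominated convergence applicable is a bound
  \<open>\<bar>\<phi> t\<bar>^n \<le> q powr (norm (c n * t) powr \<delta>)\<close> for \<open>norm (c n * t)\<close> bounded below,
  uniform in large \<open>n\<close> (\<open>stretched_exponential_bound\<close>).
  It comes from a dyadic argument: since \<open>\<bar>\<psi>\<bar> < 1\<close> away from zero, \<open>\<bar>\<phi> (t / c n)\<bar>^n \<le> q < 1\<close> on any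
  annulus (\<open>annulus_bound\<close>); this forces \<open>c (2 n) \<le> K * c n\<close> (\<open>c_doubling\<close>); and halving \<open>n\<close>
  repeatedly, which squares the bound while it divides the argument by at most \<open>K\<close>, carries every point
  of the cube into an annulus or into the region that aperiodicity controls. Gaussian smoothing
  identifies the integral of \<open>\<psi>\<close> as \<open>(2 pi)^d * g 0\<close> (\<open>fourier_inversion_at_0\<close>), so \<open>C n * u n\<close> tends to
  \<open>g 0\<close>. The same dominated convergence with the additional factor \<open>1 - \<phi>\<close>, which vanishes in the limit,
  gives \<open>u (n + 1) / u n \<longlonglongrightarrow> 1\<close>, and doubling of \<open>c\<close> gives \<open>u m \<le> K' * u n\<close> for \<open>m \<le> n \<le> 2 m\<close>.

  First returns. Splitting according to the first return yields the renewal equation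
  \<open>u n = (\<Sum>k\<le>n. f k * u (n - k))\<close>, and transience makes \<open>u\<close> summable. In that equation only the terms
  with \<open>k\<close> or \<open>n - k\<close> bounded matter asymptotically. Divided by \<open>u n\<close>, the former contribute \<open>p\<close> in
  the limit, so the convolution of \<open>u\<close> with the ratios \<open>f n / u n\<close> tends to \<open>1 - p\<close>. The inverse of \<open>u\<close>
  under convolution is the unit minus \<open>f\<close>, a summable sequence with sum \<open>1 - p\<close>; convolving with it gives
  \<open>f n / u n \<longlonglongrightarrow> (1 - p)^2\<close> (\<open>renewal_ratio\<close>).
\<close>

section \<open>Renewal sequences\<close>

lemma tannery_sequence:
  fixes a :: "nat \<Rightarrow> nat \<Rightarrow> real"
  assumes "\<And>k. (\<lambda>n. a k n) \<longlonglongrightarrow> b k"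
    and "\<forall>\<^sub>F n in sequentially. \<forall>k. \<bar>a k n\<bar> \<le> m k"
    and "summable m"
  shows "(\<lambda>n. \<Sum>k. a k n) \<longlonglongrightarrow> (\<Sum>k. b k)"
proof -
  have "eventually (\<lambda>(k,n). norm (a k n) \<le> m k) (sequentially \<times>\<^sub>F sequentially)"
    unfolding eventually_prod_filter
    using assms(2) by (intro exI[of _ "\<lambda>_. True"] exI[of _ "\<lambda>n. \<forall>k. \<bar>a k n\<bar> \<le> m k"]) auto
  from tannerys_theorem[OF assms(1) this assms(3)] show ?thesis by simp
qed

lemma suminf_restricted:
  fixes f :: "nat \<Rightarrow> real"
  shows "finite {k. P k} \<Longrightarrow> (\<Sum>k. if P k then f k else 0) = (\<Sum>k | P k. f k)"
  by (subst suminf_finite[of "{k. P k}"]) auto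

lemma convolution_tendsto:
  fixes e w :: "nat \<Rightarrow> real"
  assumes "summable (\<lambda>k. \<bar>e k\<bar>)" and "w \<longlonglongrightarrow> L"
  shows "(\<lambda>n. \<Sum>k\<le>n. e k * w (n - k)) \<longlonglongrightarrow> (\<Sum>k. e k) * L"
proof -
  obtain B where B: "\<And>n. \<bar>w n\<bar> \<le> B"
    using convergent_imp_Bseq[of w] assms(2) by (auto simp: convergent_def Bseq_def)
  define a where "a k n = (if k \<le> n then e k * w (n - k) else 0)" for k n
  have "(\<lambda>n. \<Sum>k. a k n) \<longlonglongrightarrow> (\<Sum>k. e k * L)"
  proof (rule tannery_sequence)
    fix k
    have "(\<lambda>n. a k (n + k)) \<longlonglongrightarrow> e k * L"
      unfolding a_def using assms(2) by (auto intro: tendsto_intros)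
    then show "(\<lambda>n. a k n) \<longlonglongrightarrow> e k * L"
      by (rule LIMSEQ_offset)
  next
    have "0 \<le> B" using B[of 0] by linarith
    then show "\<forall>\<^sub>F n in sequentially. \<forall>k. \<bar>a k n\<bar> \<le> \<bar>e k\<bar> * B"
      by (intro always_eventually allI) (simp add: a_def abs_mult mult_left_mono[OF B])
    show "summable (\<lambda>k. \<bar>e k\<bar> * B)"
      by (intro summable_mult2 assms(1))
  qed
  moreover have "(\<Sum>k. a k n) = (\<Sum>k\<le>n. e k * w (n - k))" for n
    unfolding a_def by (subst suminf_restricted) (auto simp: atMost_def)
  moreover have "(\<Sum>k. e k * L) = (\<Sum>k. e k) * L"
    by (rule suminf_mult2[OF summable_rabs_cancel[OF assms(1)], symmetric])
  ultimately show ?thesis by simp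
qed

text \<open>
  Dividing the renewal equation by \<open>u n\<close>, the terms with \<open>k \<le> n / 2\<close> are dominated by \<open>K * f k\<close> and converge
  to \<open>f k\<close>. Since those terms sum to \<open>p\<close> in the limit, the others, indexed by the time \<open>j = n - k\<close>
  that is left after the first return, sum to \<open>1 - p\<close>; up to a vanishing error they are the convolution \<open>w\<close> of
  \<open>u\<close> with \<open>a = f / u\<close>. Convolving \<open>w\<close> with the inverse \<open>e\<close> of \<open>u\<close> recovers \<open>a\<close>. Doubling of \<open>u\<close> and
  its summability keep the tails of all these sums uniformly small.
\<close>
theorem renewal_ratio:
  fixes u f :: "nat \<Rightarrow> real"
  assumes renewal: "\<And>n. n > 0 \<Longrightarrow> u n = (\<Sum>k\<le>n. f k * u (n - k))"
    and "u 0 = 1" "f 0 = 0"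
    and f_nonneg: "\<And>n. f n \<ge> 0" and u_nonneg: "\<And>n. u n \<ge> 0"
    and f_sums: "f sums p" and u_summable: "summable u"
    and u_pos: "\<forall>\<^sub>F n in sequentially. u n > 0"
    and ratio: "(\<lambda>n. u (Suc n) / u n) \<longlonglongrightarrow> 1"
    and doubling: "\<forall>\<^sub>F n in sequentially. \<forall>m. m \<le> n \<and> n \<le> 2 * m \<longrightarrow> u m \<le> K * u n"
  shows "(\<lambda>n. f n / u n) \<longlonglongrightarrow> (1 - p)\<^sup>2"
proof -
  \<comment> \<open>Where \<open>u n = 0\<close> also \<open>f n = 0\<close>, so \<open>f n = u n * a n\<close> holds for every \<open>n\<close>.\<close>
  define a where "a n = f n / u n" for n
  have f_le_u: "f n \<le> u n" for n
  proof (cases "n = 0")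
    case False
    have "f n * u (n - n) \<le> (\<Sum>k\<le>n. f k * u (n - k))"
      by (rule member_le_sum) (auto intro: mult_nonneg_nonneg f_nonneg u_nonneg)
    then show ?thesis using renewal[of n] False \<open>u 0 = 1\<close> by simp
  qed (simp add: assms)
  have f_eq: "f n = u n * a n" for n
    using f_le_u[of n] f_nonneg[of n] by (auto simp: a_def)
  have a_bounds: "0 \<le> a n" "a n \<le> 1" for n
    using f_le_u[of n] f_nonneg[of n] u_nonneg[of n] by (auto simp: a_def divide_le_eq_1)
  have shift: "(\<lambda>n. u (n - k) / u n) \<longlonglongrightarrow> 1" for k
  proof (induction k)
    case 0
    have "\<forall>\<^sub>F n in sequentially. 1 = u (n - 0) / u n"
      using u_pos by eventually_elim simp
    then show ?case by (rule Lim_transform_eventually[OF tendsto_const])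
  next
    case (Suc k)
    have "(\<lambda>n. u n / u (Suc n)) \<longlonglongrightarrow> 1"
      using tendsto_inverse[OF ratio] by simp
    moreover have "(\<lambda>n. u (n - k) / u n) \<longlonglongrightarrow> 1" by (rule Suc)
    ultimately have "(\<lambda>n. (u n / u (Suc n)) * (u (n - k) / u n)) \<longlonglongrightarrow> 1 * 1"
      by (rule tendsto_mult)
    moreover have "\<forall>\<^sub>F n in sequentially. (u n / u (Suc n)) * (u (n - k) / u n) = u (Suc n - Suc k) / u (Suc n)"
      using u_pos by eventually_elim simp
    ultimately have "(\<lambda>n. u (Suc n - Suc k) / u (Suc n)) \<longlonglongrightarrow> 1"
      using Lim_transform_eventually by fastforce
    then show ?case by (rule LIMSEQ_imp_Suc)
  qed
  have "\<forall>\<^sub>F n in sequentially. 0 \<le> K"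
    using doubling u_pos
  proof eventually_elim
    case (elim n)
    then have "1 * u n \<le> K * u n" by simp
    then have "1 \<le> K" using elim(2) by (rule mult_right_le_imp_le)
    then show ?case by simp
  qed
  then have K: "0 \<le> K" by simp
  have far_ratio: "\<forall>\<^sub>F n in sequentially. \<forall>k. 2 * k \<le> n \<longrightarrow> u (n - k) / u n \<le> K"
    using doubling u_pos by eventually_elim (auto simp: divide_le_eq)
  \<comment> \<open>The contribution of first returns up to time \<open>n / 2\<close>.\<close>
  define early where "early k n = (if 2 * k \<le> n then f k * (u (n - k) / u n) else 0)" for k n
  have "(\<lambda>n. \<Sum>k. early k n) \<longlonglongrightarrow> (\<Sum>k. f k)"
  proof (rule tannery_sequence)
    fix k
    have "(\<lambda>n. f k * (u (n - k) / u n)) \<longlonglongrightarrow> f k * 1"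
      by (intro tendsto_intros shift)
    moreover have "\<forall>\<^sub>F n in sequentially. f k * (u (n - k) / u n) = early k n"
      using eventually_ge_at_top[of "2 * k"] by eventually_elim (simp add: early_def)
    ultimately show "(\<lambda>n. early k n) \<longlonglongrightarrow> f k"
      using Lim_transform_eventually by fastforce
  next
    show "\<forall>\<^sub>F n in sequentially. \<forall>k. \<bar>early k n\<bar> \<le> f k * K"
      using far_ratio
    proof eventually_elim
      case (elim n)
      have "f k * (u (n - k) / u n) \<le> f k * K" if "2 * k \<le> n" for k
        using elim that f_nonneg by (intro mult_left_mono) auto
      moreover have "0 \<le> f k * K" "0 \<le> f k * (u (n - k) / u n)" for k
        by (intro mult_nonneg_nonneg divide_nonneg_nonneg K f_nonneg u_nonneg)+
      ultimately have "\<bar>early k n\<bar> \<le> f k * K" for k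
        unfolding early_def by (cases "2 * k \<le> n") (simp_all only: if_True if_False abs_of_nonneg abs_zero)
      then show ?case by blast
    qed
    show "summable (\<lambda>k. f k * K)"
      using f_sums by (intro summable_mult2) (auto simp: sums_iff)
  qed
  then have early_lim: "(\<lambda>n. \<Sum>k. early k n) \<longlonglongrightarrow> p"
    using f_sums by (simp add: sums_iff)
  \<comment> \<open>The error in replacing the late part of the renewal equation by the full convolution \<open>w n\<close>.\<close>
  define rest where "rest j n = (if j \<le> n then u j * a (n - j) * (1 - (if 2 * j < n then u (n - j) / u n else 0)) else 0)" for j n
  have "(\<lambda>n. \<Sum>j. rest j n) \<longlonglongrightarrow> (\<Sum>j. 0)"
  proof (rule tannery_sequence)
    fix j
    have "(\<lambda>n. 1 - u (n - j) / u n) \<longlonglongrightarrow> 1 - 1"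
      by (intro tendsto_intros shift)
    then have *: "(\<lambda>n. u j * \<bar>1 - u (n - j) / u n\<bar>) \<longlonglongrightarrow> 0"
      by (auto intro!: tendsto_mult_right_zero tendsto_rabs_zero)
    have "\<forall>\<^sub>F n in sequentially. norm (rest j n) \<le> u j * \<bar>1 - u (n - j) / u n\<bar>"
      using eventually_gt_at_top[of "2 * j"]
    proof eventually_elim
      case (elim n)
      have "norm (rest j n) = a (n - j) * (u j * \<bar>1 - u (n - j) / u n\<bar>)"
        using elim a_bounds u_nonneg by (simp add: rest_def abs_mult)
      also have "\<dots> \<le> 1 * (u j * \<bar>1 - u (n - j) / u n\<bar>)"
        by (intro mult_right_mono a_bounds mult_nonneg_nonneg u_nonneg) auto
      finally show ?case by simp
    qed
    then show "(\<lambda>n. rest j n) \<longlonglongrightarrow> 0"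
      by (rule Lim_null_comparison[OF _ *])
  next
    show "\<forall>\<^sub>F n in sequentially. \<forall>j. \<bar>rest j n\<bar> \<le> u j * (1 + K)"
      using far_ratio
    proof eventually_elim
      case (elim n)
      show ?case
      proof
        fix j
        define x where "x = (if 2 * j < n then u (n - j) / u n else 0)"
        have "0 \<le> x" "x \<le> K" using elim K u_nonneg by (auto simp: x_def)
        then have "a (n - j) * \<bar>1 - x\<bar> \<le> 1 * (1 + K)"
          using a_bounds by (intro mult_mono) auto
        then have "u j * (a (n - j) * \<bar>1 - x\<bar>) \<le> u j * (1 + K)"
          using u_nonneg by (intro mult_left_mono) auto
        then show "\<bar>rest j n\<bar> \<le> u j * (1 + K)"
          using K u_nonneg a_bounds by (auto simp: rest_def x_def[symmetric] abs_mult mult.assoc)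
      qed
    qed
    show "summable (\<lambda>j. u j * (1 + K))"
      by (rule summable_mult2[OF u_summable])
  qed
  then have rest_lim: "(\<lambda>n. \<Sum>j. rest j n) \<longlonglongrightarrow> 0" by simp
  define w where "w n = (\<Sum>j\<le>n. u j * a (n - j))" for n
  have "\<forall>\<^sub>F n in sequentially. 1 - (\<Sum>k. early k n) + (\<Sum>j. rest j n) = w n"
    using u_pos eventually_gt_at_top[of 0]
  proof eventually_elim
    case (elim n)
    have fin: "finite {k. 2 * k \<le> n}" by (rule finite_subset[of _ "{..n}"]) auto
    have E: "(\<Sum>k. early k n) = (\<Sum>k | 2 * k \<le> n. f k * (u (n - k) / u n))"
      unfolding early_def by (rule suminf_restricted[OF fin])
    have R: "(\<Sum>j. rest j n) = w n - (\<Sum>j | j \<le> n \<and> 2 * j < n. u j * f (n - j) / u n)"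
    proof -
      have "(\<Sum>j. rest j n) = (\<Sum>j\<le>n. u j * a (n - j) * (1 - (if 2 * j < n then u (n - j) / u n else 0)))"
        unfolding rest_def by (subst suminf_restricted) (auto simp: atMost_def)
      also have "\<dots> = (\<Sum>j\<le>n. u j * a (n - j) - (if 2 * j < n then u j * f (n - j) / u n else 0))"
        by (intro sum.cong refl) (simp add: algebra_simps f_eq)
      also have "\<dots> = w n - (\<Sum>j\<le>n. if 2 * j < n then u j * f (n - j) / u n else 0)"
        by (simp add: sum_subtractf w_def)
      finally show ?thesis
        by (simp add: sum.If_cases Int_def)
    qed
    have "u n = (\<Sum>k\<le>n. f k * u (n - k))" using renewal elim by auto
    also have "\<dots> = (\<Sum>k | 2 * k \<le> n. f k * u (n - k)) + (\<Sum>k | k \<le> n \<and> \<not> 2 * k \<le> n. f k * u (n - k))"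
      by (subst sum.union_disjoint[symmetric]) (auto intro!: sum.cong intro: fin)
    also have "(\<Sum>k | k \<le> n \<and> \<not> 2 * k \<le> n. f k * u (n - k)) = (\<Sum>j | j \<le> n \<and> 2 * j < n. u j * f (n - j))"
      by (rule sum.reindex_bij_witness[of _ "\<lambda>j. n - j" "\<lambda>j. n - j"]) auto
    finally have "1 = (\<Sum>k. early k n) + (\<Sum>j | j \<le> n \<and> 2 * j < n. u j * f (n - j) / u n)"
      using elim by (simp add: E sum_divide_distrib[symmetric] add_divide_distrib[symmetric])
    with R show ?case by simp
  qed
  then have "w \<longlonglongrightarrow> 1 - p + 0"
    by (rule Lim_transform_eventually[rotated]) (intro tendsto_intros early_lim rest_lim)
  then have w_lim: "w \<longlonglongrightarrow> 1 - p" by simp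
  \<comment> \<open>The inverse of \<open>u\<close> under convolution.\<close>
  define e where "e k = (if k = 0 then 1 else 0) - f k" for k
  have e0: "(\<lambda>k::nat. if k = 0 then 1 else 0 :: real) sums 1"
    using sums_single[of 0 "\<lambda>_. 1::real"] by simp
  have e_sum: "e sums (1 - p)"
    unfolding e_def by (intro sums_diff e0 f_sums)
  have "summable (\<lambda>k. \<bar>e k\<bar>)"
  proof (rule summable_comparison_test')
    show "summable (\<lambda>k. (if k = 0 then 1 else 0) + f k)"
      using e0 f_sums by (intro summable_add) (auto simp: sums_iff)
    show "norm \<bar>e k\<bar> \<le> (if k = 0 then 1 else 0) + f k" if "k \<ge> 0" for k
      using f_nonneg[of k] by (auto simp: e_def)
  qed
  from convolution_tendsto[OF this w_lim]
  have "(\<lambda>n. \<Sum>k\<le>n. e k * w (n - k)) \<longlonglongrightarrow> (1 - p)\<^sup>2"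
    using e_sum by (simp add: sums_iff power2_eq_square)
  moreover have "(\<Sum>k\<le>n. e k * w (n - k)) = a n" for n
  proof -
    have inv: "(\<Sum>k\<le>m. e k * u (m - k)) = (if m = 0 then 1 else 0)" for m
    proof -
      have "e k * u (m - k) = (if k = 0 then u m else 0) - f k * u (m - k)" for k
        by (simp add: e_def left_diff_distrib)
      then have "(\<Sum>k\<le>m. e k * u (m - k)) = (\<Sum>k\<le>m. if k = 0 then u m else 0) - (\<Sum>k\<le>m. f k * u (m - k))"
        by (simp only: sum_subtractf)
      also have "(\<Sum>k\<le>m. if k = 0 then u m else 0) = u m"
        by simp
      finally show ?thesis
        using renewal[of m] assms(2,3) by (cases "m = 0") auto
    qed
    have "(\<Sum>k\<le>n. e k * w (n - k)) = (\<Sum>k\<le>n. \<Sum>j\<le>n - k. e k * u j * a (n - k - j))"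
      by (simp add: w_def sum_distrib_left mult.assoc)
    also have "\<dots> = (\<Sum>(k, j)\<in>{(k, j). k + j \<le> n}. e k * u j * a (n - k - j))"
      by (subst sum.Sigma) (auto intro!: sum.cong)
    also have "\<dots> = (\<Sum>m\<le>n. \<Sum>k\<le>m. e k * u (m - k) * a (n - k - (m - k)))"
      by (rule sum.triangle_reindex_eq)
    also have "\<dots> = (\<Sum>m\<le>n. (\<Sum>k\<le>m. e k * u (m - k)) * a (n - m))"
      by (intro sum.cong refl) (auto simp: sum_distrib_right intro!: sum.cong)
    also have "\<dots> = (\<Sum>m\<le>n. if m = 0 then a n else 0)"
      by (intro sum.cong refl) (simp add: inv)
    also have "\<dots> = a n" by simp
    finally show ?thesis .
  qed
  ultimately show ?thesis by (simp add: a_def[abs_def])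
qed

text \<open>
  Summing the renewal equation up to \<open>n\<close> bounds the partial sum \<open>U\<close> of \<open>u\<close> by \<open>1 + p * U\<close>.
\<close>
lemma renewal_summable:
  fixes u f :: "nat \<Rightarrow> real"
  assumes renewal: "\<And>n. n > 0 \<Longrightarrow> u n = (\<Sum>k\<le>n. f k * u (n - k))"
    and "u 0 = 1" and f_nonneg: "\<And>n. f n \<ge> 0" and u_nonneg: "\<And>n. u n \<ge> 0"
    and f_sums: "f sums p" and "p < 1"
  shows "summable u"
proof (rule summableI_nonneg_bounded)
  fix n
  define U where "U = (\<Sum>i\<le>n. u i)"
  have "U = u 0 + (\<Sum>i\<in>{1..n}. u i)"
    unfolding U_def atMost_atLeast0 by (subst sum.atLeast_Suc_atMost) auto
  also have "(\<Sum>i\<in>{1..n}. u i) = (\<Sum>i\<in>{1..n}. \<Sum>k\<le>i. f k * u (i - k))"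
    by (intro sum.cong refl renewal) auto
  also have "\<dots> \<le> (\<Sum>i\<le>n. \<Sum>k\<le>i. f k * u (i - k))"
    by (intro sum_mono2 sum_nonneg mult_nonneg_nonneg f_nonneg u_nonneg) auto
  also have "\<dots> = (\<Sum>(k, j)\<in>{(k, j). k + j \<le> n}. f k * u j)"
    by (rule sum.triangle_reindex_eq[symmetric])
  also have "\<dots> \<le> (\<Sum>(k, j)\<in>{..n} \<times> {..n}. f k * u j)"
    by (intro sum_mono2) (auto simp: f_nonneg u_nonneg)
  also have "\<dots> = (\<Sum>k\<le>n. f k) * U"
    by (simp add: sum.cartesian_product[symmetric] sum_product U_def)
  also have "\<dots> \<le> p * U"
  proof (rule mult_right_mono)
    show "(\<Sum>k\<le>n. f k) \<le> p"
      using f_sums f_nonneg by (auto simp: sums_iff intro!: sum_le_suminf)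
    show "0 \<le> U" unfolding U_def by (intro sum_nonneg u_nonneg)
  qed
  finally have "U \<le> 1 / (1 - p)" using \<open>u 0 = 1\<close> \<open>p < 1\<close> by (simp add: field_simps)
  moreover have "(\<Sum>i<n. u i) \<le> U"
    unfolding U_def by (intro sum_mono2) (auto simp: u_nonneg)
  ultimately show "(\<Sum>i<n. u i) \<le> 1 / (1 - p)" by simp
qed (rule u_nonneg)

section \<open>Lebesgue integrals in coordinates\<close>

lemma prod_Basis_cart:
  fixes f :: "real ^ 'd \<Rightarrow> 'b::comm_monoid_mult"
  shows "(\<Prod>b\<in>Basis. f b) = (\<Prod>r\<in>UNIV. f (axis r 1))"
proof -
  have "inj (\<lambda>r::'d. axis r (1::real))" by (auto simp: inj_def axis_eq_axis)
  moreover have "(Basis :: (real ^ 'd) set) = range (\<lambda>r. axis r 1)"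
    by (auto simp: Basis_vec_def)
  ultimately show ?thesis
    using prod.reindex[of "\<lambda>r::'d. axis r (1::real)" UNIV f] by (simp add: o_def)
qed

lemma measurable_vec_nth [measurable]: "(\<lambda>x::real ^ 'd. x $ r) \<in> borel_measurable borel"
  by (intro borel_measurable_continuous_onI continuous_intros)

lemma measurable_vec_lambda [measurable (raw)]:
  fixes f :: "'d::finite \<Rightarrow> 'a \<Rightarrow> real"
  assumes "\<And>r. f r \<in> borel_measurable M"
  shows "(\<lambda>x. \<chi> r. f r x) \<in> borel_measurable M"
proof (subst borel_measurable_euclidean_space, intro ballI)
  fix b :: "real ^ 'd" assume "b \<in> Basis"
  then obtain r where "b = axis r 1" by (auto simp: Basis_vec_def)
  then show "(\<lambda>x. (\<chi> r. f r x) \<bullet> b) \<in> borel_measurable M"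
    using assms[of r] by (simp add: inner_axis)
qed

text \<open>
  The product of the one-dimensional measures: this gives access to Fubini's theorem for products of functions
  of single coordinates.
\<close>
lemma lborel_cart_eq_PiM:
  "(lborel :: (real ^ 'd) measure) = distr (PiM UNIV (\<lambda>_. lborel)) borel vec_lambda"
proof (rule lborel_eqI)
  interpret product_sigma_finite "\<lambda>_::'d. lborel :: real measure" by standard
  have meas: "(vec_lambda :: ('d \<Rightarrow> real) \<Rightarrow> _) \<in> borel_measurable (PiM UNIV (\<lambda>_. lborel))"
    using measurable_vec_lambda[of "\<lambda>r x. x r" "PiM UNIV (\<lambda>_. lborel)"] by simp
  fix l u :: "real ^ 'd"
  assume *: "\<And>b. b \<in> Basis \<Longrightarrow> l \<bullet> b \<le> u \<bullet> b"
  have le: "l $ r \<le> u $ r" for r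
    using *[of "axis r 1"] by (simp add: inner_axis)
  have "vec_lambda -` box l u \<inter> space (PiM UNIV (\<lambda>_::'d. lborel :: real measure)) =
    (\<Pi>\<^sub>E r\<in>UNIV. {l $ r <..< u $ r})"
    by (auto simp: mem_box_cart space_PiM PiE_def Pi_iff)
  then have "emeasure (distr (PiM UNIV (\<lambda>_. lborel)) borel vec_lambda) (box l u) =
    (\<Prod>r\<in>UNIV. emeasure lborel {l $ r <..< u $ r})"
    by (simp add: emeasure_distr[OF meas] emeasure_PiM)
  also have "\<dots> = (\<Prod>r\<in>UNIV. ennreal (u $ r - l $ r))"
    using le by simp
  also have "\<dots> = ennreal (\<Prod>b\<in>Basis. (u - l) \<bullet> b)"
    using le by (subst prod_ennreal) (auto simp: prod_Basis_cart inner_axis)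
  finally show "emeasure (distr (PiM UNIV (\<lambda>_. lborel)) borel vec_lambda) (box l u) = ennreal (\<Prod>b\<in>Basis. (u - l) \<bullet> b)" .
qed simp

lemma
  fixes f :: "'d::finite \<Rightarrow> real \<Rightarrow> 'b::{real_normed_field,banach,second_countable_topology}"
  assumes f: "\<And>r. integrable lborel (f r)"
  shows integrable_lborel_prod_cart: "integrable lborel (\<lambda>x::real ^ 'd. \<Prod>r\<in>UNIV. f r (x $ r))"
    and integral_lborel_prod_cart: "(LINT x|lborel. (\<Prod>r\<in>UNIV. f r (x $ r))) = (\<Prod>r\<in>UNIV. LINT s|lborel. f r s)"
proof -
  interpret product_sigma_finite "\<lambda>_::'d. lborel :: real measure" by standard
  have meas: "(vec_lambda :: ('d \<Rightarrow> real) \<Rightarrow> _) \<in> borel_measurable (PiM UNIV (\<lambda>_. lborel))"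
    using measurable_vec_lambda[of "\<lambda>r x. x r" "PiM UNIV (\<lambda>_. lborel)"] by simp
  have [measurable]: "f r \<in> borel_measurable borel" for r
    using borel_measurable_integrable[OF f[of r]] by simp
  have m: "(\<lambda>x::real ^ 'd. \<Prod>r\<in>UNIV. f r (x $ r)) \<in> borel_measurable borel"
    by measurable
  show "integrable lborel (\<lambda>x::real ^ 'd. \<Prod>r\<in>UNIV. f r (x $ r))"
    unfolding lborel_cart_eq_PiM
    using product_integrable_prod[of UNIV f, OF _ f] by (subst integrable_distr_eq[OF meas m]) simp
  show "(LINT x|lborel. (\<Prod>r\<in>UNIV. f r (x $ r))) = (\<Prod>r\<in>UNIV. LINT s|lborel. f r s)"
    unfolding lborel_cart_eq_PiM
    using product_integral_prod[of UNIV f, OF _ f] by (subst integral_distr[OF meas m]) simp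
qed

lemma integral_lborel_scale_cart:
  fixes f :: "real ^ 'd \<Rightarrow> 'b::{banach,second_countable_topology}" and s :: "real ^ 'd"
  assumes f[measurable]: "f \<in> borel_measurable borel" and s: "\<And>r. s $ r > 0"
  shows "(LINT x|lborel. f x) = (\<Prod>r\<in>UNIV. s $ r) *\<^sub>R (LINT x|lborel. f (\<chi> r. s $ r * x $ r))"
proof -
  have T: "0 + (\<Sum>j\<in>Basis. ((s \<bullet> j) * (x \<bullet> j)) *\<^sub>R j) = (\<chi> r. s $ r * x $ r)" for x :: "real ^ 'd"
  proof -
    have "(\<chi> r. s $ r * x $ r) \<bullet> j = (s \<bullet> j) * (x \<bullet> j)" if "j \<in> Basis" for j
      using that by (auto simp: Basis_vec_def inner_axis)
    then have "(\<Sum>j\<in>Basis. ((s \<bullet> j) * (x \<bullet> j)) *\<^sub>R j) = (\<Sum>j\<in>Basis. ((\<chi> r. s $ r * x $ r) \<bullet> j) *\<^sub>R j)"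
      by (intro sum.cong) auto
    then show ?thesis by (simp add: euclidean_representation)
  qed
  have nz: "s \<bullet> j \<noteq> 0" if "j \<in> Basis" for j
  proof -
    obtain r where "j = axis r 1" using \<open>j \<in> Basis\<close> by (auto simp: Basis_vec_def)
    then show ?thesis using s[of r] by (simp add: inner_axis)
  qed
  have P: "(\<Prod>j\<in>Basis. \<bar>s \<bullet> j\<bar>) = (\<Prod>r\<in>UNIV. s $ r)"
    using s by (simp add: prod_Basis_cart inner_axis less_imp_le)
  have "(lborel :: (real ^ 'd) measure) = density (distr lborel borel (\<lambda>x. \<chi> r. s $ r * x $ r)) (\<lambda>_. (\<Prod>r\<in>UNIV. s $ r))"
    using lborel_affine_euclidean[of "\<lambda>j. s \<bullet> j" 0, OF nz] unfolding T P by simp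
  then have "(LINT x|lborel. f x) = (LINT x|density (distr lborel borel (\<lambda>x. \<chi> r. s $ r * x $ r)) (\<lambda>_. ennreal (\<Prod>r\<in>UNIV. s $ r)). f x)"
    by simp
  also have "\<dots> = (LINT x|distr lborel borel (\<lambda>x. \<chi> r. s $ r * x $ r). (\<Prod>r\<in>UNIV. s $ r) *\<^sub>R f x)"
    using s by (intro integral_density) (auto intro!: AE_I2 prod_nonneg simp: less_imp_le)
  also have "\<dots> = (LINT x|lborel. (\<Prod>r\<in>UNIV. s $ r) *\<^sub>R f (\<chi> r. s $ r * x $ r))"
    by (intro integral_distr) measurable
  finally show ?thesis by simp
qed

lemma integral_lborel_divide_cart:
  fixes f :: "real ^ 'd \<Rightarrow> 'b::{banach,second_countable_topology}" and s :: "real ^ 'd"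
  assumes f: "f \<in> borel_measurable borel" and s: "\<And>r. s $ r > 0"
  shows "(\<Prod>r\<in>UNIV. s $ r) *\<^sub>R (LINT x|lborel. f x) = (LINT x|lborel. f (\<chi> r. x $ r / s $ r))"
proof -
  have "(\<Prod>r\<in>UNIV. s $ r) * (\<Prod>r\<in>UNIV. inverse (s $ r)) = 1"
    using s by (subst prod.distrib[symmetric]) (simp add: less_imp_neq[symmetric])
  then show ?thesis
    using integral_lborel_scale_cart[OF f, of "\<chi> r. inverse (s $ r)"] s
    by (simp add: divide_inverse mult.commute)
qed

lemma integral_lborel_scaleR_cart:
  fixes f :: "real ^ 'd \<Rightarrow> 'b::{banach,second_countable_topology}" and \<kappa> :: real
  assumes f: "f \<in> borel_measurable borel" and "\<kappa> > 0"
  shows "\<kappa> ^ CARD('d) *\<^sub>R (LINT x|lborel. f x) = (LINT x|lborel. f (inverse \<kappa> *\<^sub>R x))"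
proof -
  have "(\<chi> r. x $ r / \<kappa>) = inverse \<kappa> *\<^sub>R x" for x :: "real ^ 'd"
    by (simp add: vec_eq_iff divide_inverse mult.commute)
  then show ?thesis
    using integral_lborel_divide_cart[OF f, of "\<chi> r. \<kappa>"] assms(2) by simp
qed

lemma integrable_inverse_one_plus_square: "integrable lborel (\<lambda>x::real. inverse (1 + x\<^sup>2))"
  using integrable_inverse_1_plus_square by (simp add: set_integrable_def)

text \<open>
  The integrable majorant for all dominated convergence arguments on the torus below.
\<close>
lemma integrable_prod_inverse_cart:
  "integrable lborel (\<lambda>t::real ^ 'd. \<Prod>r\<in>UNIV. inverse (1 + (t $ r)\<^sup>2))"
  by (rule integrable_lborel_prod_cart) (rule integrable_inverse_one_plus_square)

text \<open>
  A stretched exponential beats every polynomial, in particular \<open>(1 + x^2)^d\<close>, and each coordinate of \<open>t\<close>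
  is at most \<open>norm t\<close>.
\<close>
lemma exp_bound_by_rational:
  fixes q \<delta> :: real
  assumes "0 < q" "q < 1" "\<delta> > 0"
  obtains B where "\<And>t::real ^ 'd. q powr (norm t powr \<delta>) \<le> B * (\<Prod>r\<in>UNIV. inverse (1 + (t $ r)\<^sup>2))" "B > 0"
proof -
  define d where "d = CARD('d)"
  define h where "h x = q powr (x powr \<delta>) * (1 + x\<^sup>2) ^ d" for x :: real
  have "((\<lambda>x. exp (- (- ln q) * x powr \<delta>) * (1 + x\<^sup>2) ^ d) \<longlongrightarrow> 0) at_top"
    using assms by real_asymp
  then have "(h \<longlongrightarrow> 0) at_top"
    using assms by (simp add: h_def[abs_def] powr_def mult.commute)
  then have "\<forall>\<^sub>F x in at_top. h x < 1"
    by (rule order_tendstoD) simp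
  then obtain A where A: "\<And>x. x \<ge> A \<Longrightarrow> h x < 1"
    by (auto simp: eventually_at_top_linorder)
  define B where "B = max 1 ((1 + \<bar>A\<bar>\<^sup>2) ^ d)"
  have B1: "1 \<le> B" unfolding B_def by (rule max.cobounded1)
  have hB: "h x \<le> B" if "x \<ge> 0" for x
  proof (cases "x \<ge> A")
    case False
    have "h x \<le> 1 * (1 + x\<^sup>2) ^ d"
      unfolding h_def using assms by (intro mult_right_mono powr_le_one_le) (auto simp: powr_le1)
    also have "\<dots> \<le> 1 * (1 + \<bar>A\<bar>\<^sup>2) ^ d"
      using False that by (intro mult_left_mono power_mono add_left_mono) (auto)
    finally show ?thesis by (simp add: B_def)
  next
    case True
    then have "h x \<le> 1" using A[of x] by simp
    then show ?thesis using B1 by simp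
  qed
  have "q powr (norm t powr \<delta>) \<le> B * (\<Prod>r\<in>UNIV. inverse (1 + (t $ r)\<^sup>2))" for t :: "real ^ 'd"
  proof -
    have pos: "(\<Prod>r\<in>UNIV. 1 + (t $ r)\<^sup>2) > 0" by (intro prod_pos) (auto simp: add_pos_nonneg)
    have "(\<Prod>r\<in>UNIV. 1 + (t $ r)\<^sup>2) \<le> (\<Prod>r\<in>(UNIV :: 'd set). 1 + (norm t)\<^sup>2)"
    proof (rule prod_mono)
      fix r
      have "\<bar>t $ r\<bar> \<le> norm t" by (rule component_le_norm_cart)
      then have "(t $ r)\<^sup>2 \<le> (norm t)\<^sup>2" by (metis abs_le_square_iff abs_norm_cancel)
      then show "0 \<le> 1 + (t $ r)\<^sup>2 \<and> 1 + (t $ r)\<^sup>2 \<le> 1 + (norm t)\<^sup>2" by auto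
    qed
    also have "\<dots> = (1 + (norm t)\<^sup>2) ^ d" by (simp add: d_def)
    finally have "q powr (norm t powr \<delta>) * (\<Prod>r\<in>UNIV. 1 + (t $ r)\<^sup>2) \<le> h (norm t)"
      unfolding h_def by (intro mult_left_mono) auto
    also have "\<dots> \<le> B" by (rule hB) simp
    finally have "q powr (norm t powr \<delta>) \<le> B * inverse (\<Prod>r\<in>UNIV. 1 + (t $ r)\<^sup>2)"
      using pos by (simp add: field_simps)
    then show ?thesis by (simp only: prod_inversef[symmetric] o_def)
  qed
  then show thesis using B1 by (intro that[of B]) auto
qed

section \<open>Componentwise scaling\<close>

text \<open>
  Norming the components of a random vector by \<open>s\<close> divides the argument of its characteristic function by \<open>s\<close>;
  \<open>cmul\<close> undoes this.
\<close>
definition cdiv :: "real ^ 'd \<Rightarrow> real ^ 'd \<Rightarrow> real ^ 'd" where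
  "cdiv t s = (\<chi> r. t $ r / s $ r)"

definition cmul :: "real ^ 'd \<Rightarrow> real ^ 'd \<Rightarrow> real ^ 'd" where
  "cmul s t = (\<chi> r. s $ r * t $ r)"

lemma cdiv_nth [simp]: "cdiv t s $ r = t $ r / s $ r"
  by (simp add: cdiv_def)

lemma cmul_nth [simp]: "cmul s t $ r = s $ r * t $ r"
  by (simp add: cmul_def)

lemma cdiv_cmul: "(\<And>r. s $ r > 0) \<Longrightarrow> cdiv (cmul s t) s = t"
  by (simp add: vec_eq_iff less_imp_neq[symmetric])

lemma norm_axis_real: "norm (axis r x :: real ^ 'd) = \<bar>x\<bar>"
proof -
  have "(axis r x :: real ^ 'd) = x *\<^sub>R axis r 1"
    by (simp add: vec_eq_iff axis_def)
  then show ?thesis by (simp add: norm_axis_1)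
qed

lemma sets_cube [measurable]: "cube a \<in> sets (borel :: (real ^ 'd) measure)"
proof -
  have "closed (cube a :: (real ^ 'd) set)"
    unfolding cube_def by (auto intro!: closed_Collect_all closed_Collect_conj closed_Collect_le continuous_intros)
  then show ?thesis by simp
qed

lemma norm_le_of_cube:
  fixes t :: "real ^ 'd" and a :: real
  assumes "t \<in> cube a" shows "norm t \<le> CARD('d) * a"
proof -
  have "norm t \<le> (\<Sum>r\<in>UNIV. \<bar>t $ r\<bar>)" by (rule norm_le_l1_cart)
  also have "\<dots> \<le> (\<Sum>r\<in>(UNIV :: 'd set). a)"
    using assms by (intro sum_mono) (auto simp: cube_def abs_le_iff minus_le_iff)
  finally show ?thesis by simp
qed

lemma norm_cmul_mono:
  fixes t :: "real ^ 'd"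
  assumes "\<And>r. 0 \<le> s $ r" "\<And>r. s $ r \<le> K * s' $ r" "K \<ge> 0"
  shows "norm (cmul s t) \<le> K * norm (cmul s' t)"
proof -
  have "norm (cmul s t) \<le> norm (K *\<^sub>R cmul s' t)"
  proof (rule norm_le_componentwise_cart)
    fix r
    have "\<bar>s $ r\<bar> * \<bar>t $ r\<bar> \<le> \<bar>K * s' $ r\<bar> * \<bar>t $ r\<bar>"
      using assms(1,2)[of r] by (intro mult_right_mono) auto
    then show "norm (cmul s t $ r) \<le> norm ((K *\<^sub>R cmul s' t) $ r)"
      by (simp add: abs_mult mult.assoc)
  qed
  then show ?thesis using assms by simp
qed

section \<open>Local limits from scaled characteristic functions\<close>

text \<open>
  The Fourier-analytic content of the hypotheses: \<open>\<phi>\<close> is the characteristic function of a lattice step, \<open>c\<close> the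
  norming sequence and \<open>\<psi>\<close> the characteristic function of the limit. Convergence is required along moving
  arguments, which amounts to locally uniform convergence and is what compactness arguments need.
\<close>
locale scaled_char_functions =
  fixes \<phi> \<psi> :: "real ^ 'd \<Rightarrow> complex" and c :: "nat \<Rightarrow> real ^ 'd"
  assumes c_pos: "n \<ge> 1 \<Longrightarrow> c n $ r > 0"
    and norm_phi: "cmod (\<phi> t) \<le> 1"
    and phi_meas [measurable]: "\<phi> \<in> borel_measurable borel"
    and phi_period: "\<phi> (axis r (2 * pi * of_int j)) = 1"
    and phi_aperiodic: "\<epsilon> > 0 \<Longrightarrow> \<exists>\<theta><1. \<forall>t\<in>cube pi - cube \<epsilon>. cmod (\<phi> t) \<le> \<theta>"
    and cont_conv: "filterlim m at_top sequentially \<Longrightarrow> w \<longlonglongrightarrow> s \<Longrightarrow>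
       (\<lambda>k::nat. \<phi> (cdiv (w k) (c (m k))) ^ m k) \<longlonglongrightarrow> \<psi> s"
    and psi_lt_1: "s \<noteq> 0 \<Longrightarrow> cmod (\<psi> s) < 1"
    and psi_0: "\<psi> 0 = 1"
begin

text \<open>
  Otherwise compactness of the annulus would produce a limit point \<open>l\<close>, away from zero, with \<open>\<bar>\<psi> l\<bar> \<ge> 1\<close>.
\<close>
lemma annulus_bound:
  assumes "0 < a"
  obtains q n0 where "0 < q" "q < 1" "n0 \<ge> 1"
    "\<And>n t. n \<ge> n0 \<Longrightarrow> a \<le> norm t \<Longrightarrow> norm t \<le> b \<Longrightarrow> cmod (\<phi> (cdiv t (c n))) ^ n \<le> q"
proof (rule ccontr)
  assume "\<not> thesis"
  note contra = this
  have "\<exists>n t. n \<ge> k \<and> a \<le> norm t \<and> norm t \<le> b \<and> cmod (\<phi> (cdiv t (c n))) ^ n > 1 - 1 / (real k + 2)" for k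
  proof (rule ccontr)
    assume *: "\<not> ?thesis"
    have "cmod (\<phi> (cdiv t (c n))) ^ n \<le> 1 - 1 / (real k + 2)"
      if "n \<ge> max 1 k" "a \<le> norm t" "norm t \<le> b" for n t
      using * that by (auto simp: not_less)
    moreover have "0 < 1 - 1 / (real k + 2)" "1 - 1 / (real k + 2) < 1"
      by (auto simp: field_simps)
    ultimately show False
      using that[of "1 - 1 / (real k + 2)" "max 1 k"] contra by auto
  qed
  then obtain m t where mt: "\<And>k. m k \<ge> k" "\<And>k. a \<le> norm (t k)" "\<And>k. norm (t k) \<le> b"
      "\<And>k. cmod (\<phi> (cdiv (t k) (c (m k)))) ^ m k > 1 - 1 / (real k + 2)"
    by metis
  have "compact (cball (0::real ^ 'd) b)" by simp
  moreover have "\<forall>k. t k \<in> cball 0 b" using mt(3) by simp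
  ultimately obtain l h where lh: "strict_mono (h :: nat \<Rightarrow> nat)" "(t \<circ> h) \<longlonglongrightarrow> l"
    by (meson compact_imp_seq_compact seq_compactE)
  have "a \<le> norm l"
    by (rule LIMSEQ_le_const[OF tendsto_norm[OF lh(2)]]) (use mt(2) in auto)
  then have "l \<noteq> 0" using assms by auto
  have "filterlim (m \<circ> h) at_top sequentially"
    using mt(1) seq_suble[OF lh(1)]
    by (intro filterlim_at_top_mono[OF filterlim_ident] always_eventually allI) (metis comp_apply le_trans)
  from tendsto_norm[OF cont_conv[OF this lh(2)]]
  have 1: "(\<lambda>k. cmod (\<phi> (cdiv (t (h k)) (c (m (h k))))) ^ m (h k)) \<longlonglongrightarrow> cmod (\<psi> l)"
    by (simp add: norm_power)
  have "(\<lambda>k. 1 - 1 / (real k + 2)) \<longlonglongrightarrow> 1" by real_asymp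
  from LIMSEQ_subseq_LIMSEQ[OF this lh(1)]
  have 2: "(\<lambda>k. 1 - 1 / (real (h k) + 2)) \<longlonglongrightarrow> 1" by (simp add: o_def)
  have "1 \<le> cmod (\<psi> l)"
    by (rule LIMSEQ_le[OF 2 1]) (use mt(4) in \<open>auto intro: less_imp_le\<close>)
  with psi_lt_1[OF \<open>l \<noteq> 0\<close>] show False by simp
qed

text \<open>
  If \<open>c n $ r\<close> stayed bounded, some multiple \<open>j\<close> of the period \<open>2 pi\<close> would, after scaling by \<open>c n $ r\<close>, lie in a
  fixed annulus; but there \<open>\<phi>\<close> equals 1, against \<open>annulus_bound\<close>.
\<close>
lemma c_at_top: "filterlim (\<lambda>n. c n $ r) at_top sequentially"
  unfolding filterlim_at_top
proof
  fix B
  have two_pi: "0 < 2 * pi" by simp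
  obtain q n0 where q: "0 < q" "q < 1" "n0 \<ge> 1"
    "\<And>n t. n \<ge> n0 \<Longrightarrow> 2 * pi \<le> norm t \<Longrightarrow> norm t \<le> 2 * pi * (1 + B) \<Longrightarrow> cmod (\<phi> (cdiv t (c n))) ^ n \<le> q"
    by (rule annulus_bound[OF two_pi, of "2 * pi * (1 + B)"]) (rule that)
  have "B \<le> c n $ r" if n: "n \<ge> n0" for n
  proof (rule ccontr)
    assume less: "\<not> B \<le> c n $ r"
    have pos: "c n $ r > 0" using n q(3) by (intro c_pos) auto
    define j where "j = \<lceil>1 / c n $ r\<rceil>"
    have "1 / c n $ r \<le> j" "j \<le> 1 / c n $ r + 1" unfolding j_def by linarith+
    then have j: "1 \<le> j * c n $ r" "j * c n $ r \<le> 1 + B"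
      using less pos by (auto simp: field_simps)
    define t :: "real ^ 'd" where "t = axis r (2 * pi * (j * c n $ r))"
    have "norm t = 2 * pi * (j * c n $ r)"
      using order_trans[OF zero_le_one j(1)] pi_gt_zero unfolding t_def norm_axis_real
      by (intro abs_of_nonneg mult_nonneg_nonneg[of "2 * pi"]) auto
    then have "2 * pi \<le> norm t" "norm t \<le> 2 * pi * (1 + B)"
      using j pi_gt_zero by (auto intro: mult_left_mono)
    then have "cmod (\<phi> (cdiv t (c n))) ^ n \<le> q" using q(4) n by blast
    moreover have "cdiv t (c n) = axis r (2 * pi * of_int j)"
      using pos by (auto simp: vec_eq_iff t_def axis_def)
    ultimately show False using q(2) by (simp add: phi_period)
  qed
  then show "\<forall>\<^sub>F n in sequentially. B \<le> c n $ r"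
    by (auto simp: eventually_sequentially)
qed

text \<open>
  Suppose \<open>c n $ r\<close> is much larger than \<open>c m $ r\<close> with \<open>n \<le> 2 m + 1\<close>, and evaluate \<open>\<phi>\<close> at the point \<open>v\<close> which
  is the unit vector divided by \<open>c n\<close>. On the scale of \<open>c m\<close> this point is close to zero, so \<open>\<bar>\<phi> v\<bar>^m\<close> is close
  to 1 and so is its cube, which is at most \<open>\<bar>\<phi> v\<bar>^n\<close>. The annulus bound on the scale of \<open>c n\<close> forbids that.
\<close>
lemma c_doubling:
  obtains K n0 where "K > 1" "n0 \<ge> 1"
    "\<And>m n r. n0 \<le> m \<Longrightarrow> m \<le> n \<Longrightarrow> n \<le> 2 * m + 1 \<Longrightarrow> c n $ r \<le> K * c m $ r"
proof (rule ccontr)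
  assume "\<not> thesis"
  note contra = this
  have "\<exists>m n r. Suc k \<le> m \<and> m \<le> n \<and> n \<le> 2 * m + 1 \<and> c n $ r > (real k + 2) * c m $ r" for k
    using contra that[of "real k + 2" "Suc k"] by (force simp: not_less)
  then obtain m n r where *: "\<And>k. Suc k \<le> m k" "\<And>k. m k \<le> n k" "\<And>k. n k \<le> 2 * m k + 1"
      "\<And>k. c (n k) $ r k > (real k + 2) * c (m k) $ r k"
    by metis
  have pos: "c (m k) $ r k > 0" "c (n k) $ r k > 0" for k
    using *(1,2)[of k] by (auto intro!: c_pos)
  obtain q n0 where q: "0 < q" "q < 1" "n0 \<ge> 1"
    "\<And>n t. n \<ge> n0 \<Longrightarrow> 1 \<le> norm t \<Longrightarrow> norm t \<le> 1 \<Longrightarrow> cmod (\<phi> (cdiv t (c n))) ^ n \<le> q"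
    by (rule annulus_bound[OF zero_less_one, of 1]) (rule that)
  define t :: "nat \<Rightarrow> real ^ 'd" where "t k = axis (r k) (c (m k) $ r k / c (n k) $ r k)" for k
  define v where "v k = cdiv (axis (r k) 1) (c (n k))" for k
  have v: "cdiv (t k) (c (m k)) = v k" for k
    using pos[of k] by (auto simp: vec_eq_iff t_def v_def axis_def)
  have "norm (t k) \<le> 1 / (real k + 2)" for k
    using pos[of k] *(4)[of k] by (simp add: t_def norm_axis_real field_simps)
  moreover have "(\<lambda>k. 1 / (real k + 2)) \<longlonglongrightarrow> 0" by real_asymp
  ultimately have "t \<longlonglongrightarrow> 0"
    by (intro Lim_null_comparison[of t]) auto
  moreover have "filterlim m at_top sequentially"
    using *(1) by (intro filterlim_at_top_mono[OF filterlim_ident] always_eventually allI) (metis Suc_leD)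
  ultimately have "(\<lambda>k. \<phi> (v k) ^ m k) \<longlonglongrightarrow> 1"
    using cont_conv[of m t 0] by (simp add: v psi_0)
  from tendsto_power[OF tendsto_norm[OF this], of 3]
  have lim: "(\<lambda>k. (cmod (\<phi> (v k)) ^ m k) ^ 3) \<longlonglongrightarrow> 1" by (simp add: norm_power)
  have "(cmod (\<phi> (v k)) ^ m k) ^ 3 \<le> q" if "k \<ge> n0" for k
  proof -
    have "(cmod (\<phi> (v k)) ^ m k) ^ 3 = cmod (\<phi> (v k)) ^ (m k * 3)" by (simp add: power_mult)
    also have "\<dots> \<le> cmod (\<phi> (v k)) ^ n k"
      using *(1,3)[of k] by (intro power_decreasing norm_phi) auto
    also have "\<dots> \<le> q"
      unfolding v_def using *(1,2)[of k] that by (intro q(4)) (auto simp: norm_axis_real)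
    finally show ?thesis .
  qed
  then have "1 \<le> q"
    by (intro LIMSEQ_le_const2[OF lim]) blast
  with q show False by simp
qed

text \<open>
  Induction on \<open>n\<close> with \<open>x = norm (c n * t)\<close>. For \<open>x \<le> 1\<close> the annulus bound applies. For \<open>x > 1\<close> and large \<open>n\<close>
  pass to \<open>m = n div 2\<close>: the left side at \<open>n\<close> is at most the square of the one at \<open>m\<close>, while \<open>x powr \<delta>\<close> is at
  most twice the corresponding quantity at \<open>m\<close>, because \<open>c n \<le> K * c m\<close> and \<open>\<delta>\<close> is chosen with
  \<open>K powr \<delta> = 2\<close>. For \<open>x > 1\<close> and the finitely many remaining \<open>n\<close> the point \<open>t\<close> stays away from zero,
  where aperiodicity bounds \<open>\<bar>\<phi> t\<bar>\<close>.
\<close>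
lemma stretched_exponential_bound:
  obtains q \<delta> K n0 where "0 < q" "q < 1" "\<delta> > 0" "K > 1" "n0 \<ge> 1"
    "\<And>n t. n \<ge> n0 \<Longrightarrow> t \<in> cube pi \<Longrightarrow> 1 / K \<le> norm (cmul (c n) t) \<Longrightarrow>
       cmod (\<phi> t) ^ n \<le> q powr (norm (cmul (c n) t) powr \<delta>)"
proof -
  obtain K n1 where K: "K > 1" "n1 \<ge> 1"
    "\<And>m n r. n1 \<le> m \<Longrightarrow> m \<le> n \<Longrightarrow> n \<le> 2 * m + 1 \<Longrightarrow> c n $ r \<le> K * c m $ r"
    by (rule c_doubling) (rule that)
  have K_pos: "0 < 1 / K" using K by simp
  obtain q0 n2 where q0: "0 < q0" "q0 < 1" "n2 \<ge> 1"
    "\<And>n t. n \<ge> n2 \<Longrightarrow> 1 / K \<le> norm t \<Longrightarrow> norm t \<le> 1 \<Longrightarrow> cmod (\<phi> (cdiv t (c n))) ^ n \<le> q0"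
    by (rule annulus_bound[OF K_pos, of 1]) (rule that)
  define n0 where "n0 = max n1 n2"
  have n0: "n0 \<ge> 1" "n0 \<ge> n1" "n0 \<ge> n2" using K by (auto simp: n0_def)
  define \<delta> where "\<delta> = log K 2"
  have \<delta>: "\<delta> > 0" "K powr \<delta> = 2" using K by (auto simp: \<delta>_def)
  \<comment> \<open>The starting indices \<open>n0 \<le> n < 2 * n0\<close> are those at which halving stops.\<close>
  define A where "A = Max (insert 1 ((\<lambda>(n, r). c n $ r) ` ({n0..<2 * n0} \<times> UNIV)))"
  have "A \<ge> 1" unfolding A_def by (rule Max_ge) auto
  moreover have "c n $ r \<le> A" if "n0 \<le> n" "n < 2 * n0" for n r
    unfolding A_def using that by (intro Max_ge) (force intro!: finite_imageI)+
  ultimately have A: "A \<ge> 1" "\<And>n r. n0 \<le> n \<Longrightarrow> n < 2 * n0 \<Longrightarrow> c n $ r \<le> A" by blast+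
  define d where "d = real CARD('d)"
  have d: "d > 0" by (simp add: d_def)
  \<comment> \<open>\<open>R\<close> bounds \<open>x\<close> at the starting indices.\<close>
  define R where "R = A * (d * pi)"
  have R: "R > 0" using A d by (simp add: R_def)
  obtain \<theta>0 where \<theta>0: "\<theta>0 < 1" "\<And>t. t \<in> cube pi - cube (1 / (2 * A * d)) \<Longrightarrow> cmod (\<phi> t) \<le> \<theta>0"
    using phi_aperiodic[of "1 / (2 * A * d)"] A d by auto
  \<comment> \<open>Keeps \<open>\<theta>\<close> positive, so that real powers of it can be inverted.\<close>
  define \<theta> where "\<theta> = max \<theta>0 (1 / 2)"
  have \<theta>: "0 < \<theta>" "\<theta> < 1" "\<theta>0 \<le> \<theta>" using \<theta>0 by (auto simp: \<theta>_def)
  define b where "b = R powr \<delta>"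
  have b: "b > 0" using R by (simp add: b_def)
  \<comment> \<open>The second entry makes \<open>\<theta> \<le> q powr (x powr \<delta>)\<close> for all \<open>x \<le> R\<close>.\<close>
  define q where "q = max q0 (\<theta> powr (1 / b))"
  have "\<theta> powr (1 / b) < 1"
    using \<theta> b powr_less_mono2[of "1 / b" \<theta> 1] by simp
  then have q: "0 < q" "q < 1" "q0 \<le> q" using q0 by (auto simp: q_def)
  have "\<theta> = (\<theta> powr (1 / b)) powr b" using \<theta> b by (simp add: powr_powr)
  also have "\<dots> \<le> q powr b" using b by (intro powr_mono2) (auto simp: q_def)
  finally have q\<theta>: "\<theta> \<le> q powr b" .
  have antimono: "q powr x \<le> q powr y" if "y \<le> x" for x y
    using that q by (simp add: powr_mono')
  have "cmod (\<phi> t) ^ n \<le> q powr (norm (cmul (c n) t) powr \<delta>)"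
    if "n \<ge> n0" "t \<in> cube pi" "1 / K \<le> norm (cmul (c n) t)" for n t
    using that
  proof (induction n rule: less_induct)
    case (less n)
    define x where "x = norm (cmul (c n) t)"
    have cn: "c n $ r > 0" for r using less.prems n0 by (intro c_pos) auto
    consider "x \<le> 1" | "x > 1" "n < 2 * n0" | "x > 1" "n \<ge> 2 * n0" by linarith
    then have "cmod (\<phi> t) ^ n \<le> q powr (x powr \<delta>)"
    proof cases
      case 1
      have "cmod (\<phi> (cdiv (cmul (c n) t) (c n))) ^ n \<le> q0"
        using less.prems n0 1 by (intro q0(4)) (auto simp: x_def)
      then have "cmod (\<phi> t) ^ n \<le> q powr 1" using q cn by (simp add: cdiv_cmul)
      also have "\<dots> \<le> q powr (x powr \<delta>)"
        using 1 \<delta> by (intro antimono powr_le1) (auto simp: x_def)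
      finally show ?thesis .
    next
      case 2
      have "x \<le> A * norm (cmul 1 t)"
        unfolding x_def using A less.prems 2 cn by (intro norm_cmul_mono) (auto simp: less_imp_le)
      then have xA: "x \<le> A * norm t" by (simp add: cmul_def)
      have "norm t \<le> d * pi" using norm_le_of_cube[OF less.prems(2)] by (simp add: d_def)
      then have "x \<le> R" using xA A unfolding R_def by (meson mult_left_mono order_trans zero_le_one)
      then have xb: "x powr \<delta> \<le> b" unfolding b_def using \<delta> by (intro powr_mono2) (auto simp: x_def)
      have "t \<notin> cube (1 / (2 * A * d))"
      proof
        assume "t \<in> cube (1 / (2 * A * d))"
        from norm_le_of_cube[OF this] have "norm t \<le> 1 / (2 * A)" using d by (simp add: d_def)
        then have "A * norm t \<le> 1 / 2" using A by (simp add: field_simps)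
        with xA 2 show False by simp
      qed
      with less.prems have "cmod (\<phi> t) \<le> \<theta>" using \<theta>0(2)[of t] \<theta>(3) by auto
      then have "cmod (\<phi> t) ^ n \<le> \<theta> ^ n" by (rule power_mono) simp
      also have "\<dots> \<le> \<theta> ^ 1" using less.prems n0 \<theta> by (intro power_decreasing) auto
      also have "\<dots> \<le> q powr b" using q\<theta> by simp
      also have "\<dots> \<le> q powr (x powr \<delta>)" by (intro antimono xb)
      finally show ?thesis .
    next
      case 3
      define m where "m = n div 2"
      have m: "n0 \<le> m" "m < n" "n \<le> 2 * m + 1" "2 * m \<le> n" using 3 n0 by (auto simp: m_def)
      define y where "y = norm (cmul (c m) t)"
      have "x \<le> K * y"
        unfolding x_def y_def using K m n0 cn by (intro norm_cmul_mono) (auto simp: less_imp_le)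
      then have y: "1 / K \<le> y" "x \<le> K * y" using 3 K by (auto simp: field_simps)
      have "x powr \<delta> \<le> (K * y) powr \<delta>"
        using y \<delta> by (intro powr_mono2) (auto simp: x_def)
      also have "\<dots> = 2 * y powr \<delta>" using K \<delta> by (simp add: powr_mult y_def)
      finally have xy: "x powr \<delta> \<le> 2 * y powr \<delta>" .
      have "cmod (\<phi> t) ^ n \<le> cmod (\<phi> t) ^ (m * 2)"
        using m by (intro power_decreasing norm_phi) auto
      also have "\<dots> = (cmod (\<phi> t) ^ m)\<^sup>2" by (simp add: power_mult)
      also have "\<dots> \<le> (q powr (y powr \<delta>))\<^sup>2"
        using less.IH[of m] m less.prems y(1) by (intro power_mono) (auto simp: y_def)
      also have "\<dots> = q powr (2 * y powr \<delta>)"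
        using q by (simp add: power2_eq_square powr_add[symmetric])
      also have "\<dots> \<le> q powr (x powr \<delta>)" by (intro antimono xy)
      finally show ?thesis .
    qed
    then show ?case by (simp add: x_def)
  qed
  then show thesis by (intro that[of q \<delta> K n0] q \<delta> K n0)
qed

text \<open>
  The constant \<open>1 / q\<close> absorbs the points with \<open>norm (c n * t) < 1 / K\<close>, which the stretched exponential bound
  does not cover and where the trivial bound 1 suffices.
\<close>
lemma domination:
  obtains B n0 where "n0 \<ge> 1"
    "\<And>n t. n \<ge> n0 \<Longrightarrow> t \<in> cube pi \<Longrightarrow>
       cmod (\<phi> t) ^ n \<le> B * (\<Prod>r\<in>UNIV. inverse (1 + (c n $ r * t $ r)\<^sup>2))"
proof -
  obtain q \<delta> K n0 where *: "0 < q" "q < 1" "\<delta> > 0" "K > 1" "n0 \<ge> 1"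
    "\<And>n t. n \<ge> n0 \<Longrightarrow> t \<in> cube pi \<Longrightarrow> 1 / K \<le> norm (cmul (c n) t) \<Longrightarrow>
       cmod (\<phi> t) ^ n \<le> q powr (norm (cmul (c n) t) powr \<delta>)"
    by (rule stretched_exponential_bound) (rule that)
  obtain B where B: "\<And>t::real ^ 'd. q powr (norm t powr \<delta>) \<le> B * (\<Prod>r\<in>UNIV. inverse (1 + (t $ r)\<^sup>2))"
    by (rule exp_bound_by_rational[OF *(1-3), where 'd = 'd]) (rule that)
  have "cmod (\<phi> t) ^ n \<le> (B / q) * (\<Prod>r\<in>UNIV. inverse (1 + (c n $ r * t $ r)\<^sup>2))"
    if n: "n \<ge> n0" "t \<in> cube pi" for n t
  proof -
    define x where "x = norm (cmul (c n) t)"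
    have "q * cmod (\<phi> t) ^ n \<le> q powr (x powr \<delta>)"
    proof (cases "1 / K \<le> x")
      case True
      have "q * cmod (\<phi> t) ^ n \<le> 1 * cmod (\<phi> t) ^ n" using * by (intro mult_right_mono) auto
      then show ?thesis using *(6)[OF n] True unfolding x_def by linarith
    next
      case False
      have "1 / K \<le> 1" using * by simp
      then have "x \<le> 1" using False by linarith
      then have "x powr \<delta> \<le> 1" using * by (intro powr_le1) (auto simp: x_def)
      then have "q powr 1 \<le> q powr (x powr \<delta>)" using * by (intro powr_mono') auto
      moreover have "q * cmod (\<phi> t) ^ n \<le> q * 1"
        using * norm_phi by (intro mult_left_mono power_le_one) auto
      moreover have "q powr 1 = q" using * by simp
      ultimately show ?thesis by linarith
    qed
    also have "\<dots> \<le> B * (\<Prod>r\<in>UNIV. inverse (1 + (c n $ r * t $ r)\<^sup>2))"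
      using B[of "cmul (c n) t"] by (simp add: x_def)
    finally show ?thesis using * by (simp add: field_simps)
  qed
  then show thesis using * by (intro that[of n0 "B / q"]) auto
qed

text \<open>
  The factor \<open>h\<close> allows the same limit theorem to serve for \<open>\<phi>^n\<close> and for the increments \<open>\<phi>^n * (1 - \<phi>)\<close>.
\<close>
lemma scaled_integral_tendsto:
  assumes [measurable]: "h \<in> borel_measurable borel"
    and h_bound: "\<And>t. cmod (h t) \<le> H"
    and h_lim: "\<And>t. (\<lambda>n. h (cdiv t (c n))) \<longlonglongrightarrow> L"
  shows "integrable lborel \<psi>"
    and "(\<lambda>n. (\<Prod>r\<in>UNIV. c n $ r) *\<^sub>R (LINT t|lborel. indicator (cube pi) t *\<^sub>R (\<phi> t ^ n * h t))) \<longlonglongrightarrow> (LINT t|lborel. \<psi> t * L)"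
proof -
  obtain B n0 where B: "n0 \<ge> 1"
    "\<And>n t. n \<ge> n0 \<Longrightarrow> t \<in> cube pi \<Longrightarrow>
       cmod (\<phi> t) ^ n \<le> B * (\<Prod>r\<in>UNIV. inverse (1 + (c n $ r * t $ r)\<^sup>2))"
    by (rule domination) (rule that)
  define G where "G t = B * (\<Prod>r\<in>UNIV. inverse (1 + (t $ r)\<^sup>2))" for t :: "real ^ 'd"
  have G: "integrable lborel G"
    unfolding G_def by (intro integrable_mult_right integrable_prod_inverse_cart)
  have [measurable]: "(\<lambda>t. cdiv t (c n)) \<in> borel_measurable borel" for n
    unfolding cdiv_def by measurable
  \<comment> \<open>The integrand after the substitution of \<open>t / c n\<close> for \<open>t\<close>.\<close>
  define F where "F k n t = indicator (cube pi) (cdiv t (c n)) *\<^sub>R (\<phi> (cdiv t (c n)) ^ n * k (cdiv t (c n)))"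
    for k :: "real ^ 'd \<Rightarrow> complex" and n t
  have F_meas: "F k n \<in> borel_measurable lborel" if [measurable]: "k \<in> borel_measurable borel" for k n
    unfolding F_def[abs_def] by measurable
  have F_lim: "(\<lambda>n. F k n t) \<longlonglongrightarrow> \<psi> t * L'" if "(\<lambda>n. k (cdiv t (c n))) \<longlonglongrightarrow> L'" for k t L'
  proof -
    have "\<forall>\<^sub>F n in sequentially. \<bar>t $ r\<bar> / pi \<le> c n $ r" for r
      using c_at_top[of r] by (simp add: filterlim_at_top)
    then have "\<forall>\<^sub>F n in sequentially. \<forall>r. \<bar>t $ r\<bar> / pi \<le> c n $ r"
      by (rule eventually_all_finite)
    then have "\<forall>\<^sub>F n in sequentially. \<phi> (cdiv t (c n)) ^ n * k (cdiv t (c n)) = F k n t"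
      using eventually_ge_at_top[of 1]
    proof eventually_elim
      case (elim n)
      have "\<bar>t $ r / c n $ r\<bar> \<le> pi" for r
      proof -
        have "c n $ r > 0" using elim by (intro c_pos)
        moreover have "\<bar>t $ r\<bar> / pi \<le> c n $ r" using elim by blast
        ultimately show ?thesis by (simp add: abs_divide field_simps)
      qed
      then have "cdiv t (c n) \<in> cube pi"
        unfolding cube_def mem_Collect_eq cdiv_nth atLeastAtMost_iff abs_le_iff by (simp add: minus_le_iff)
      then show ?case by (simp add: F_def)
    qed
    moreover have "(\<lambda>n. \<phi> (cdiv t (c n)) ^ n * k (cdiv t (c n))) \<longlonglongrightarrow> \<psi> t * L'"
      using cont_conv[OF filterlim_ident tendsto_const, of t] that by (intro tendsto_mult)
    ultimately show ?thesis by (rule Lim_transform_eventually[rotated])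
  qed
  have F_bound: "norm (F k n t) \<le> \<bar>H'\<bar> * G t" if "n \<ge> n0" "\<And>t. cmod (k t) \<le> H'" for k n t H'
  proof (cases "cdiv t (c n) \<in> cube pi")
    case True
    have "c n $ r > 0" for r using that(1) B(1) by (intro c_pos) auto
    then have eq: "c n $ r * cdiv t (c n) $ r = t $ r" for r by (simp add: less_imp_neq[symmetric])
    have *: "cmod (\<phi> (cdiv t (c n))) ^ n \<le> G t"
      using B(2)[OF that(1) True] unfolding G_def eq .
    have "0 \<le> cmod (\<phi> (cdiv t (c n))) ^ n" by simp
    then have G0: "0 \<le> G t" using * by linarith
    have "cmod (\<phi> (cdiv t (c n))) ^ n * cmod (k (cdiv t (c n))) \<le> G t * \<bar>H'\<bar>"
      using that(2)[of "cdiv t (c n)"] by (intro mult_mono * G0) auto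
    then show ?thesis using True by (simp add: F_def norm_mult norm_power mult.commute)
  next
    case False
    have "0 \<le> cmod (\<phi> 0) ^ n0" by simp
    also have "\<dots> \<le> B" using B(2)[of n0 0] by (simp add: cube_def)
    finally have "0 \<le> G t" unfolding G_def by (intro mult_nonneg_nonneg prod_nonneg) auto
    with False show ?thesis by (simp add: F_def)
  qed
  have dct: "integrable lborel (\<lambda>t. \<psi> t * L')" "(\<lambda>n. LINT t|lborel. F k n t) \<longlonglongrightarrow> (LINT t|lborel. \<psi> t * L')"
    if k[measurable]: "k \<in> borel_measurable borel" "\<And>t. cmod (k t) \<le> H'"
      "\<And>t. (\<lambda>n. k (cdiv t (c n))) \<longlonglongrightarrow> L'" for k H' L'
  proof -
    have meas: "(\<lambda>t. \<psi> t * L') \<in> borel_measurable lborel"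
      by (rule borel_measurable_LIMSEQ_metric[OF F_meas[OF k(1)] F_lim[OF k(3)]])
    have w: "integrable lborel (\<lambda>t. \<bar>H'\<bar> * G t)" using G by simp
    have lim: "AE t in lborel. (\<lambda>n. F k (n + n0) t) \<longlonglongrightarrow> \<psi> t * L'"
      by (intro AE_I2 LIMSEQ_ignore_initial_segment F_lim k(3))
    have bound: "AE t in lborel. norm (F k (n + n0) t) \<le> \<bar>H'\<bar> * G t" for n
      by (intro AE_I2 F_bound k(2)) simp
    show "integrable lborel (\<lambda>t. \<psi> t * L')"
      by (rule integrable_dominated_convergence[OF meas F_meas[OF k(1)] w lim bound])
    show "(\<lambda>n. LINT t|lborel. F k n t) \<longlonglongrightarrow> (LINT t|lborel. \<psi> t * L')"
      by (rule LIMSEQ_offset) (rule integral_dominated_convergence[OF meas F_meas[OF k(1)] w lim bound])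
  qed
  show "integrable lborel \<psi>"
    using dct(1)[of "\<lambda>_. 1" 1 1] by simp
  have "\<forall>\<^sub>F n in sequentially. (LINT t|lborel. F h n t) =
    (\<Prod>r\<in>UNIV. c n $ r) *\<^sub>R (LINT t|lborel. indicator (cube pi) t *\<^sub>R (\<phi> t ^ n * h t))"
    using eventually_ge_at_top[of 1]
  proof eventually_elim
    case (elim n)
    have "(\<lambda>t. indicator (cube pi) t *\<^sub>R (\<phi> t ^ n * h t)) \<in> borel_measurable borel" by measurable
    from integral_lborel_divide_cart[OF this, of "c n"] c_pos[OF elim]
    show ?case by (simp add: F_def cdiv_def)
  qed
  then show "(\<lambda>n. (\<Prod>r\<in>UNIV. c n $ r) *\<^sub>R (LINT t|lborel. indicator (cube pi) t *\<^sub>R (\<phi> t ^ n * h t))) \<longlonglongrightarrow> (LINT t|lborel. \<psi> t * L)"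
    by (rule Lim_transform_eventually[rotated]) (rule dct(2)[OF assms(1) h_bound h_lim])
qed

end

section \<open>Convergence of characteristic functions\<close>

lemma cmod_iexp_diff: "cmod (iexp x - iexp y) \<le> min 2 \<bar>x - y\<bar>"
proof -
  have "iexp x - iexp y = iexp y * (iexp (x - y) - 1)"
    by (simp add: right_diff_distrib exp_add[symmetric] algebra_simps)
  then have "cmod (iexp x - iexp y) = cmod (iexp (x - y) - 1)" by (simp add: norm_mult)
  also have "\<dots> \<le> \<bar>x - y\<bar>" using iexp_approx1[of "x - y" 0] by simp
  finally have "cmod (iexp x - iexp y) \<le> \<bar>x - y\<bar>" .
  moreover have "cmod (iexp x - iexp y) \<le> 2"
    using norm_triangle_ineq4[of "iexp x" "iexp y"] by simp
  ultimately show ?thesis by simp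
qed

lemma (in prob_space) integrable_iexp:
  fixes Z :: "'a \<Rightarrow> real"
  assumes [measurable]: "Z \<in> borel_measurable M"
  shows "integrable M (\<lambda>\<omega>. iexp (Z \<omega>))"
  by (rule integrable_const_bound[of _ 1]) auto

text \<open>
  For a fixed argument this is weak convergence tested on cosine and sine. Moving the argument by \<open>v\<close> changes the
  characteristic function at \<open>Z\<close> by at most the expectation of \<open>min 2 (norm v * norm Z)\<close>. That test function is
  again continuous and bounded, so its expectation is controlled by the one at \<open>Y\<close>, which tends to 0 with
  \<open>norm v\<close>. The family is therefore asymptotically equicontinuous.
\<close>
lemma char_vec_continuous_convergence:
  fixes Z :: "nat \<Rightarrow> 'a \<Rightarrow> real ^ 'd" and Y :: "'b \<Rightarrow> real ^ 'd"
  assumes "prob_space M" "prob_space N"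
    and Z[measurable]: "\<And>n. Z n \<in> borel_measurable M" and Y[measurable]: "Y \<in> borel_measurable N"
    and conv: "conv_in_distribution M Z N Y"
    and m: "filterlim m at_top sequentially" and w: "w \<longlonglongrightarrow> s"
  shows "(\<lambda>k. CLINT \<omega>|M. iexp (w k \<bullet> Z (m k) \<omega>)) \<longlonglongrightarrow> (CLINT \<omega>|N. iexp (s \<bullet> Y \<omega>))"
proof -
  interpret M: prob_space M by fact
  interpret N: prob_space N by fact
  have weak: "(\<lambda>k. LINT \<omega>|M. f (Z (m k) \<omega>)) \<longlonglongrightarrow> (LINT \<omega>|N. f (Y \<omega>))"
    if "continuous_on UNIV f" "\<And>x. \<bar>f x\<bar> \<le> B" for f :: "real ^ 'd \<Rightarrow> real" and B
  proof -
    have "bounded (range f)" using that(2) by (auto simp: bounded_iff)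
    with conv that(1) have "(\<lambda>n. LINT \<omega>|M. f (Z n \<omega>)) \<longlonglongrightarrow> (LINT \<omega>|N. f (Y \<omega>))"
      by (auto simp: conv_in_distribution_def)
    then show ?thesis by (rule filterlim_compose[OF _ m])
  qed
  have fixed: "(\<lambda>k. CLINT \<omega>|M. iexp (s \<bullet> Z (m k) \<omega>)) \<longlonglongrightarrow> (CLINT \<omega>|N. iexp (s \<bullet> Y \<omega>))"
  proof -
    have "(\<lambda>k. LINT \<omega>|M. cos (s \<bullet> Z (m k) \<omega>)) \<longlonglongrightarrow> (LINT \<omega>|N. cos (s \<bullet> Y \<omega>))"
      "(\<lambda>k. LINT \<omega>|M. sin (s \<bullet> Z (m k) \<omega>)) \<longlonglongrightarrow> (LINT \<omega>|N. sin (s \<bullet> Y \<omega>))"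
      by (intro weak[of _ 1] continuous_intros; simp)+
    moreover have "Re (CLINT \<omega>|M. iexp (s \<bullet> Z k \<omega>)) = (LINT \<omega>|M. cos (s \<bullet> Z k \<omega>))"
      "Im (CLINT \<omega>|M. iexp (s \<bullet> Z k \<omega>)) = (LINT \<omega>|M. sin (s \<bullet> Z k \<omega>))" for k
      using M.integrable_iexp[of "\<lambda>\<omega>. s \<bullet> Z k \<omega>"]
      by (simp_all add: integral_Re[symmetric] integral_Im[symmetric] Re_exp Im_exp)
    moreover have "Re (CLINT \<omega>|N. iexp (s \<bullet> Y \<omega>)) = (LINT \<omega>|N. cos (s \<bullet> Y \<omega>))"
      "Im (CLINT \<omega>|N. iexp (s \<bullet> Y \<omega>)) = (LINT \<omega>|N. sin (s \<bullet> Y \<omega>))"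
      using N.integrable_iexp[of "\<lambda>\<omega>. s \<bullet> Y \<omega>"]
      by (simp_all add: integral_Re[symmetric] integral_Im[symmetric] Re_exp Im_exp)
    ultimately show ?thesis unfolding tendsto_complex_iff by simp
  qed
  define h where "h j z = min 2 (inverse (real (Suc j)) * norm z)" for j and z :: "real ^ 'd"
  have h: "continuous_on UNIV (h j)" "\<bar>h j z\<bar> \<le> 2" for j z
    unfolding h_def by (auto intro!: continuous_intros simp: abs_le_iff)
  have [measurable]: "h j \<in> borel_measurable borel" for j
    by (intro borel_measurable_continuous_onI h)
  have "(\<lambda>j. LINT \<omega>|N. h j (Y \<omega>)) \<longlonglongrightarrow> (LINT \<omega>|N. 0)"
  proof (rule integral_dominated_convergence[where w = "\<lambda>_. 2"])
    have "(\<lambda>j. min 2 (inverse (real (Suc j)) * norm z)) \<longlonglongrightarrow> min 2 (0 * norm z)" for z :: "real ^ 'd"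
      by (intro tendsto_min tendsto_mult tendsto_const LIMSEQ_inverse_real_of_nat)
    then show "AE \<omega> in N. (\<lambda>j. h j (Y \<omega>)) \<longlonglongrightarrow> 0" by (simp add: h_def)
  qed (use h(2) in auto)
  then have h_small: "(\<lambda>j. LINT \<omega>|N. h j (Y \<omega>)) \<longlonglongrightarrow> 0" by simp
  have "(\<lambda>k. (CLINT \<omega>|M. iexp (w k \<bullet> Z (m k) \<omega>)) - (CLINT \<omega>|M. iexp (s \<bullet> Z (m k) \<omega>))) \<longlonglongrightarrow> 0"
  proof (rule tendstoI)
    fix e :: real assume e: "e > 0"
    from order_tendstoD(2)[OF h_small e] obtain j where j: "(LINT \<omega>|N. h j (Y \<omega>)) < e"
      by (auto simp: eventually_sequentially)
    have "\<forall>\<^sub>F k in sequentially. (LINT \<omega>|M. h j (Z (m k) \<omega>)) < e"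
      by (rule order_tendstoD(2)[OF weak[OF h(1) h(2)] j])
    moreover have "\<forall>\<^sub>F k in sequentially. dist (w k) s < inverse (real (Suc j))"
      by (rule tendstoD[OF w]) simp
    ultimately show "\<forall>\<^sub>F k in sequentially.
      dist ((CLINT \<omega>|M. iexp (w k \<bullet> Z (m k) \<omega>)) - (CLINT \<omega>|M. iexp (s \<bullet> Z (m k) \<omega>))) 0 < e"
    proof eventually_elim
      case (elim k)
      have int: "integrable M (\<lambda>\<omega>. iexp (v \<bullet> Z (m k) \<omega>))" for v
        by (rule M.integrable_iexp) measurable
      have "cmod (CLINT \<omega>|M. iexp (w k \<bullet> Z (m k) \<omega>) - iexp (s \<bullet> Z (m k) \<omega>)) \<le> (LINT \<omega>|M. h j (Z (m k) \<omega>))"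
      proof (rule order_trans[OF integral_norm_bound], rule integral_mono)
        show "integrable M (\<lambda>\<omega>. cmod (iexp (w k \<bullet> Z (m k) \<omega>) - iexp (s \<bullet> Z (m k) \<omega>)))"
          using int by (intro integrable_norm Bochner_Integration.integrable_diff)
        show "integrable M (\<lambda>\<omega>. h j (Z (m k) \<omega>))"
          using h(2) by (intro M.integrable_const_bound[of _ 2]) auto
        fix \<omega>
        have "\<bar>w k \<bullet> Z (m k) \<omega> - s \<bullet> Z (m k) \<omega>\<bar> = \<bar>(w k - s) \<bullet> Z (m k) \<omega>\<bar>"
          by (simp add: inner_diff_left)
        also have "\<dots> \<le> norm (w k - s) * norm (Z (m k) \<omega>)" by (rule Cauchy_Schwarz_ineq2)
        also have "\<dots> \<le> inverse (real (Suc j)) * norm (Z (m k) \<omega>)"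
          using elim(2) by (intro mult_right_mono) (auto simp: dist_norm)
        finally show "cmod (iexp (w k \<bullet> Z (m k) \<omega>) - iexp (s \<bullet> Z (m k) \<omega>)) \<le> h j (Z (m k) \<omega>)"
          using cmod_iexp_diff[of "w k \<bullet> Z (m k) \<omega>" "s \<bullet> Z (m k) \<omega>"] by (simp add: h_def)
      qed
      with elim(1) int show ?case by (simp add: dist_norm)
    qed
  qed
  from tendsto_add[OF this fixed] show ?thesis by simp
qed

text \<open>
  Modulus 1 at \<open>s\<close> would confine \<open>s \<bullet> Y\<close> almost surely to a translate of \<open>2 pi \<int>\<close>, that is, confine \<open>Y\<close> to
  countably many hyperplanes, which are null sets.
\<close>
lemma char_vec_lt_1:
  fixes Y :: "'b \<Rightarrow> real ^ 'd"
  assumes "prob_space N" and Y[measurable]: "Y \<in> borel_measurable N"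
    and ac: "distributed N lborel Y f" and "s \<noteq> 0"
  shows "cmod (CLINT \<omega>|N. iexp (s \<bullet> Y \<omega>)) < 1"
proof (rule ccontr)
  interpret N: prob_space N by fact
  define z where "z = (CLINT \<omega>|N. iexp (s \<bullet> Y \<omega>))"
  have int: "integrable N (\<lambda>\<omega>. iexp (s \<bullet> Y \<omega>))" by (rule N.integrable_iexp) measurable
  assume "\<not> cmod (CLINT \<omega>|N. iexp (s \<bullet> Y \<omega>)) < 1"
  then have z1: "1 \<le> cmod z" by (simp add: z_def)
  define \<theta> where "\<theta> = Arg z"
  have z: "z = cmod z * iexp \<theta>" unfolding \<theta>_def by (metis Arg_eq z1 norm_zero not_one_le_zero)
  have "(LINT \<omega>|N. cos (s \<bullet> Y \<omega> - \<theta>)) = Re (CLINT \<omega>|N. iexp (- \<theta>) * iexp (s \<bullet> Y \<omega>))"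
  proof -
    have "cos (x - \<theta>) = Re (iexp (- \<theta>) * iexp x)" for x
      by (simp add: exp_add[symmetric] Re_exp algebra_simps)
    then have "(LINT \<omega>|N. cos (s \<bullet> Y \<omega> - \<theta>)) = (LINT \<omega>|N. Re (iexp (- \<theta>) * iexp (s \<bullet> Y \<omega>)))"
      by simp
    also have "\<dots> = Re (CLINT \<omega>|N. iexp (- \<theta>) * iexp (s \<bullet> Y \<omega>))"
      by (intro integral_Re integrable_mult_right int)
    finally show ?thesis .
  qed
  also have "\<dots> = Re (iexp (- \<theta>) * z)" using int by (simp add: z_def)
  also have "iexp (- \<theta>) * z = cmod z"
    by (subst z) (simp add: exp_add[symmetric] mult.left_commute)
  finally have eq: "(LINT \<omega>|N. cos (s \<bullet> Y \<omega> - \<theta>)) = cmod z" by simp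
  have icos: "integrable N (\<lambda>\<omega>. cos (s \<bullet> Y \<omega> - \<theta>))"
    by (intro N.integrable_const_bound[of _ 1]) auto
  have "(LINT \<omega>|N. 1 - cos (s \<bullet> Y \<omega> - \<theta>)) = 1 - cmod z"
    using icos by (simp add: eq N.prob_space)
  moreover have "(LINT \<omega>|N. 1 - cos (s \<bullet> Y \<omega> - \<theta>)) \<ge> 0" by (intro integral_nonneg_AE) auto
  ultimately have "(LINT \<omega>|N. 1 - cos (s \<bullet> Y \<omega> - \<theta>)) = 0" using z1 by simp
  then have "AE \<omega> in N. 1 - cos (s \<bullet> Y \<omega> - \<theta>) = 0"
    using icos by (subst (asm) integral_nonneg_eq_0_iff_AE) auto
  then have "AE \<omega> in N. s \<bullet> Y \<omega> \<in> (\<lambda>k. \<theta> + 2 * pi * of_int k) ` UNIV"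
  proof eventually_elim
    case (elim \<omega>)
    then have "cos (s \<bullet> Y \<omega> - \<theta>) = 1" by simp
    then obtain k :: int where "s \<bullet> Y \<omega> - \<theta> = of_int k * 2 * pi" by (auto simp: cos_one_2pi_int)
    then show ?case by (intro image_eqI[of _ _ k]) (auto simp: algebra_simps)
  qed
  moreover have "AE \<omega> in N. s \<bullet> Y \<omega> \<noteq> \<theta> + 2 * pi * of_int k" for k
  proof -
    have "negligible {y. s \<bullet> y = \<theta> + 2 * pi * of_int k}"
      by (rule negligible_hyperplane) (use \<open>s \<noteq> 0\<close> in simp)
    then have "AE y in lebesgue. s \<bullet> y \<noteq> \<theta> + 2 * pi * of_int k"
      by (simp add: negligible_iff_null_sets eventually_ae_filter) blast
    then have "AE y in lborel. s \<bullet> y \<noteq> \<theta> + 2 * pi * of_int k"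
      by (simp add: AE_completion_iff)
    then have "AE y in density lborel f. s \<bullet> y \<noteq> \<theta> + 2 * pi * of_int k"
      using ac by (subst AE_density) (auto simp: distributed_def)
    moreover have "distr N lborel Y = density lborel f"
      using ac by (simp add: distributed_def)
    ultimately have "AE y in distr N lborel Y. s \<bullet> y \<noteq> \<theta> + 2 * pi * of_int k"
      by (simp only:)
    then show ?thesis
      by (subst (asm) AE_distr_iff) auto
  qed
  then have "AE \<omega> in N. \<forall>k. s \<bullet> Y \<omega> \<noteq> \<theta> + 2 * pi * of_int k"
    by (simp add: AE_all_countable)
  ultimately have "AE \<omega> in N. False" by eventually_elim auto
  then show False by simp
qed

section \<open>Fourier inversion at the origin\<close>

lemma integral_std_normal_density_iexp:
  "(CLINT s|lborel. std_normal_density s *\<^sub>R iexp (x * s)) = exp (- (x\<^sup>2) / 2)"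
proof -
  have "exp (- (x\<^sup>2) / 2) = char std_normal_distribution x"
    by (simp add: char_std_normal_distribution)
  also have "\<dots> = (CLINT s|lborel. std_normal_density s *\<^sub>R iexp (x * s))"
    unfolding char_def by (subst integral_density) (auto)
  finally show ?thesis by simp
qed

definition gauss_cart :: "real ^ 'd \<Rightarrow> real" where
  "gauss_cart x = (\<Prod>r\<in>UNIV. std_normal_density (x $ r))"

lemma gauss_cart_nonneg: "0 \<le> gauss_cart x"
  by (simp add: gauss_cart_def prod_nonneg)

lemma gauss_cart_meas [measurable]: "gauss_cart \<in> borel_measurable borel"
  unfolding gauss_cart_def by measurable

lemma
  shows integrable_gauss_cart: "integrable lborel (gauss_cart :: real ^ 'd \<Rightarrow> real)"
    and integral_gauss_cart: "(LINT x|lborel. gauss_cart (x :: real ^ 'd)) = 1"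
  unfolding gauss_cart_def[abs_def]
  by (rule integrable_lborel_prod_cart, simp)
     (subst integral_lborel_prod_cart, simp_all)

lemma gauss_cart_eq:
  "gauss_cart (x :: real ^ 'd) = (1 / sqrt (2 * pi)) ^ CARD('d) * exp (- (norm x)\<^sup>2 / 2)"
proof -
  have "gauss_cart x = (\<Prod>r\<in>(UNIV :: 'd set). 1 / sqrt (2 * pi)) * (\<Prod>r\<in>UNIV. exp (- (x $ r)\<^sup>2 / 2))"
    unfolding gauss_cart_def std_normal_density_def by (rule prod.distrib)
  then show ?thesis
    by (simp add: exp_sum[symmetric] norm_vec_def L2_set_def sum_nonneg sum_negf sum_divide_distrib)
qed

lemma gauss_cart_le: "gauss_cart (x :: real ^ 'd) \<le> gauss_cart (0 :: real ^ 'd)"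
  by (simp add: gauss_cart_eq mult_left_mono)

text \<open>
  The Gaussian density is, up to a constant, its own Fourier transform; this makes it the smoothing kernel of choice.
\<close>
lemma integral_gauss_cart_iexp:
  fixes y :: "real ^ 'd"
  shows "(CLINT t|lborel. gauss_cart t *\<^sub>R iexp (t \<bullet> y)) = sqrt (2 * pi) ^ CARD('d) * gauss_cart y"
proof -
  have "gauss_cart t *\<^sub>R iexp (t \<bullet> y) = (\<Prod>r\<in>UNIV. std_normal_density (t $ r) *\<^sub>R iexp (y $ r * t $ r))" for t
    by (simp add: gauss_cart_def scaleR_conv_of_real prod.distrib inner_vec_def exp_sum[symmetric] sum_distrib_left mult.commute)
  moreover have "integrable lborel (\<lambda>s. std_normal_density s *\<^sub>R iexp (x * s))" for x
    by (rule Bochner_Integration.integrable_bound[of _ std_normal_density]) auto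
  ultimately have "(CLINT t|lborel. gauss_cart t *\<^sub>R iexp (t \<bullet> y)) = (\<Prod>r\<in>UNIV. CLINT s|lborel. std_normal_density s *\<^sub>R iexp (y $ r * s))"
    using integral_lborel_prod_cart[of "\<lambda>r s. std_normal_density s *\<^sub>R iexp (y $ r * s)"] by simp
  also have "\<dots> = (\<Prod>r\<in>UNIV. complex_of_real (exp (- (y $ r)\<^sup>2 / 2)))"
    by (simp only: integral_std_normal_density_iexp)
  also have "\<dots> = complex_of_real (exp (- (norm y)\<^sup>2 / 2))"
    by (simp add: of_real_prod[symmetric] exp_sum[symmetric] norm_vec_def L2_set_def sum_nonneg sum_negf sum_divide_distrib)
  also have "\<dots> = sqrt (2 * pi) ^ CARD('d) * gauss_cart y"
    by (simp add: gauss_cart_eq power_one_over)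
  finally show ?thesis .
qed

text \<open>
  The density \<open>g\<close> need not be bounded, so it is cut at height \<open>g 0 + 1\<close>. The bounded part is handled by
  dominated convergence after rescaling. The excess is integrable and vanishes near the origin, where the kernel
  concentrates; elsewhere the kernel tends to zero uniformly.
\<close>
lemma gauss_approximate_identity:
  fixes g :: "real ^ 'd \<Rightarrow> real"
  assumes g_nonneg: "\<And>y. g y \<ge> 0" and g_cont: "continuous_on UNIV g" and g_int: "integrable lborel g"
  shows "(\<lambda>k. real (Suc k) ^ CARD('d) * (LINT y|lborel. g y * gauss_cart (real (Suc k) *\<^sub>R y))) \<longlonglongrightarrow> g 0"
proof -
  define d where "d = CARD('d)"
  have d: "d > 0" by (simp add: d_def)
  have [measurable]: "g \<in> borel_measurable borel" using g_cont by (rule borel_measurable_continuous_onI)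
  define b where "b y = min (g y) (g 0 + 1)" for y
  have b_bound: "\<bar>b y\<bar> \<le> g 0 + 1" for y using g_nonneg[of y] g_nonneg[of 0] by (auto simp: b_def)
  have b_cont: "continuous_on UNIV b" unfolding b_def by (intro continuous_intros g_cont)
  have [measurable]: "b \<in> borel_measurable borel" using b_cont by (rule borel_measurable_continuous_onI)
  have "isCont b 0" using b_cont by (simp add: continuous_on_eq_continuous_at)
  define a where "a y = g y - b y" for y
  have a_nonneg: "0 \<le> a y" "a y \<le> g y" for y using g_nonneg[of y] g_nonneg[of 0] by (auto simp: a_def b_def)
  have [measurable]: "a \<in> borel_measurable borel" unfolding a_def by measurable
  have a_int: "integrable lborel a"
    by (rule Bochner_Integration.integrable_bound[OF g_int]) (use a_nonneg in \<open>auto intro!: AE_I2 simp: order_trans[OF _ abs_ge_self]\<close>)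
  have part_b: "(\<lambda>k. real (Suc k) ^ d * (LINT y|lborel. b y * gauss_cart (real (Suc k) *\<^sub>R y))) \<longlonglongrightarrow> g 0"
  proof -
    have "real (Suc k) ^ d * (LINT y|lborel. b y * gauss_cart (real (Suc k) *\<^sub>R y)) =
        (LINT z|lborel. b (inverse (real (Suc k)) *\<^sub>R z) * gauss_cart z)" for k
    proof -
      define \<kappa> where "\<kappa> = real (Suc k)"
      have \<kappa>: "\<kappa> > 0" by (simp add: \<kappa>_def)
      have "(\<lambda>y. b y * gauss_cart (\<kappa> *\<^sub>R y)) \<in> borel_measurable borel" by measurable
      from integral_lborel_scaleR_cart[OF this \<kappa>] \<kappa>
      show ?thesis unfolding \<kappa>_def[symmetric] by (simp add: d_def)
    qed
    moreover have "(\<lambda>k. LINT z|lborel. b (inverse (real (Suc k)) *\<^sub>R z) * gauss_cart z) \<longlonglongrightarrow> (LINT z|lborel. b 0 * gauss_cart (z :: real ^ 'd))"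
    proof (rule integral_dominated_convergence[where w = "\<lambda>z. (g 0 + 1) * gauss_cart z"])
      show "integrable lborel (\<lambda>z::real ^ 'd. (g 0 + 1) * gauss_cart z)"
        by (intro integrable_mult_right integrable_gauss_cart)
      show "AE z in lborel. norm (b (inverse (real (Suc k)) *\<^sub>R z) * gauss_cart z) \<le> (g 0 + 1) * gauss_cart z" for k
        unfolding real_norm_def abs_mult abs_of_nonneg[OF gauss_cart_nonneg]
        by (intro AE_I2 mult_right_mono b_bound gauss_cart_nonneg)
      have "(\<lambda>k. inverse (real (Suc k)) *\<^sub>R z) \<longlonglongrightarrow> 0 *\<^sub>R z" for z :: "real ^ 'd"
        by (intro tendsto_scaleR tendsto_const LIMSEQ_inverse_real_of_nat)
      then have "(\<lambda>k. b (inverse (real (Suc k)) *\<^sub>R z)) \<longlonglongrightarrow> b 0" for z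
        by (intro isCont_tendsto_compose[OF \<open>isCont b 0\<close>]) simp
      then show "AE z in lborel. (\<lambda>k. b (inverse (real (Suc k)) *\<^sub>R z) * gauss_cart z) \<longlonglongrightarrow> b 0 * gauss_cart z"
        by (intro AE_I2 tendsto_mult tendsto_const)
    qed measurable
    moreover have "b 0 = g 0" by (simp add: b_def)
    ultimately show ?thesis by (simp add: integral_gauss_cart)
  qed
  have part_a: "(\<lambda>k. real (Suc k) ^ d * (LINT y|lborel. a y * gauss_cart (real (Suc k) *\<^sub>R y))) \<longlonglongrightarrow> 0"
  proof -
    have "isCont g 0" using g_cont by (simp add: continuous_on_eq_continuous_at)
    then obtain \<delta> where "\<delta> > 0" "\<forall>y. dist y 0 < \<delta> \<longrightarrow> dist (g y) (g 0) < 1"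
      using zero_less_one unfolding continuous_at_eps_delta by metis
    then have \<delta>: "\<delta> > 0" "\<And>y. norm y < \<delta> \<Longrightarrow> \<bar>g y - g 0\<bar> < 1"
      by (simp_all add: dist_real_def)
    define e where "e k = (1 / sqrt (2 * pi)) ^ d * exp (- (real (Suc k) * \<delta>)\<^sup>2 / 2)" for k
    have le: "a y * gauss_cart (real (Suc k) *\<^sub>R y) \<le> e k * a y" for k y
    proof (cases "norm y < \<delta>")
      case True
      then have "a y = 0" using \<delta>(2)[of y] by (auto simp: a_def b_def)
      then show ?thesis by simp
    next
      case False
      then have "(real (Suc k) * \<delta>)\<^sup>2 \<le> (real (Suc k) * norm y)\<^sup>2"
        using \<delta> by (intro power_mono mult_left_mono) auto
      then have "gauss_cart (real (Suc k) *\<^sub>R y) \<le> e k"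
        unfolding e_def d_def gauss_cart_eq by (intro mult_left_mono) auto
      then have "a y * gauss_cart (real (Suc k) *\<^sub>R y) \<le> a y * e k"
        using a_nonneg(1) by (rule mult_left_mono)
      then show ?thesis by (simp only: mult.commute)
    qed
    have int: "integrable lborel (\<lambda>y. a y * gauss_cart (real (Suc k) *\<^sub>R y))" for k
    proof (rule Bochner_Integration.integrable_bound[of _ "\<lambda>y. e k * a y"])
      have "\<bar>a y * gauss_cart (real (Suc k) *\<^sub>R y)\<bar> \<le> \<bar>e k * a y\<bar>" for y
        using le[of y k] mult_nonneg_nonneg[OF a_nonneg(1) gauss_cart_nonneg, of y "real (Suc k) *\<^sub>R y"] by linarith
      then show "AE y in lborel. norm (a y * gauss_cart (real (Suc k) *\<^sub>R y)) \<le> norm (e k * a y)"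
        unfolding real_norm_def by (intro AE_I2)
    qed (use a_int in auto)
    have "(LINT y|lborel. a y * gauss_cart (real (Suc k) *\<^sub>R y)) \<le> e k * (LINT y|lborel. a y)" for k
      using integral_mono[OF int _ le, of k] a_int by simp
    from mult_left_mono[OF this zero_le_power[OF of_nat_0_le_iff]]
    have upper: "real (Suc k) ^ d * (LINT y|lborel. a y * gauss_cart (real (Suc k) *\<^sub>R y)) \<le> real (Suc k) ^ d * e k * (LINT y|lborel. a y)" for k
      by (simp only: mult.assoc)
    have lower: "0 \<le> real (Suc k) ^ d * (LINT y|lborel. a y * gauss_cart (real (Suc k) *\<^sub>R y))" for k
      by (intro mult_nonneg_nonneg integral_nonneg_AE AE_I2 a_nonneg gauss_cart_nonneg) auto
    have lim: "(\<lambda>k. real (Suc k) ^ d * e k * (LINT y|lborel. a y)) \<longlonglongrightarrow> 0"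
    proof -
      have "((\<lambda>x. x ^ d * exp (- (x * \<delta>)\<^sup>2 / 2)) \<longlongrightarrow> 0) at_top"
        using \<delta>(1) by real_asymp
      from filterlim_compose[OF this filterlim_compose[OF filterlim_real_sequentially filterlim_Suc]]
      have "(\<lambda>k. real (Suc k) ^ d * exp (- (real (Suc k) * \<delta>)\<^sup>2 / 2)) \<longlonglongrightarrow> 0" .
      then have "(\<lambda>k. (1 / sqrt (2 * pi)) ^ d * (real (Suc k) ^ d * exp (- (real (Suc k) * \<delta>)\<^sup>2 / 2)) * (LINT y|lborel. a y)) \<longlonglongrightarrow> 0"
        by (intro tendsto_mult_left_zero tendsto_mult_right_zero)
      then show ?thesis by (simp only: e_def mult.left_commute mult.assoc)
    qed
    show ?thesis
      by (rule tendsto_sandwich[OF always_eventually[OF allI, OF lower] always_eventually[OF allI, OF upper] tendsto_const lim])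
  qed
  have "(LINT y|lborel. g y * gauss_cart (real (Suc k) *\<^sub>R y)) =
      (LINT y|lborel. b y * gauss_cart (real (Suc k) *\<^sub>R y)) + (LINT y|lborel. a y * gauss_cart (real (Suc k) *\<^sub>R y))" for k
  proof -
    have int: "integrable lborel (\<lambda>y. f y * gauss_cart (real (Suc k) *\<^sub>R y))"
      if [measurable]: "f \<in> borel_measurable borel" and "\<And>y. 0 \<le> f y" "\<And>y. f y \<le> g y" for f
    proof (rule Bochner_Integration.integrable_bound[of _ "\<lambda>y. gauss_cart (0 :: real ^ 'd) * g y"])
      have le: "f y * gauss_cart (real (Suc k) *\<^sub>R y) \<le> g y * gauss_cart (0 :: real ^ 'd)" for y
        using that g_nonneg gauss_cart_nonneg gauss_cart_le by (intro mult_mono) auto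
      have "\<bar>f y * gauss_cart (real (Suc k) *\<^sub>R y)\<bar> \<le> \<bar>gauss_cart (0 :: real ^ 'd) * g y\<bar>" for y
        using le[of y] mult_nonneg_nonneg[OF that(2) gauss_cart_nonneg, of y "real (Suc k) *\<^sub>R y"]
        by (simp only: mult.commute[of "gauss_cart 0"])
      then show "AE y in lborel. norm (f y * gauss_cart (real (Suc k) *\<^sub>R y)) \<le> norm (gauss_cart (0 :: real ^ 'd) * g y)"
        unfolding real_norm_def by (intro AE_I2)
    qed (use g_int in auto)
    have "integrable lborel (\<lambda>y. a y * gauss_cart (real (Suc k) *\<^sub>R y))"
      "integrable lborel (\<lambda>y. b y * gauss_cart (real (Suc k) *\<^sub>R y))"
      by (intro int; use a_nonneg g_nonneg in \<open>auto simp: b_def add_nonneg_nonneg\<close>)+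
    then show ?thesis
      by (subst Bochner_Integration.integral_add[symmetric]) (auto simp: a_def algebra_simps)
  qed
  with tendsto_add[OF part_b part_a] show ?thesis by (simp add: d_def distrib_left)
qed

text \<open>
  Integrating \<open>\<psi>\<close> against a widened Gaussian equals, by Fubini and \<open>integral_gauss_cart_iexp\<close>, integrating \<open>g\<close> against
  a narrowed one. As the width grows, the former tends to a multiple of the integral of \<open>\<psi>\<close> and the latter to a multiple of
  \<open>g 0\<close>.
\<close>
theorem fourier_inversion_at_0:
  fixes g :: "real ^ 'd \<Rightarrow> real"
  assumes g_nonneg: "\<And>y. g y \<ge> 0" and g_cont: "continuous_on UNIV g" and g_int: "integrable lborel g"
    and psi: "\<And>t. \<psi> t = (CLINT y|lborel. g y *\<^sub>R iexp (t \<bullet> y))"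
    and psi_int: "integrable lborel \<psi>"
  shows "(CLINT t|lborel. \<psi> t) = (2 * pi) ^ CARD('d) * g 0"
proof -
  define d where "d = CARD('d)"
  define S where "S = sqrt (2 * pi) ^ d"
  have S: "S > 0" by (simp add: S_def)
  have [measurable]: "g \<in> borel_measurable borel" using g_cont by (rule borel_measurable_continuous_onI)
  have psi_meas[measurable]: "\<psi> \<in> borel_measurable borel" using borel_measurable_integrable[OF psi_int] by simp
  have smooth: "(CLINT t|lborel. gauss_cart (inverse (real (Suc k)) *\<^sub>R t) *\<^sub>R \<psi> t) =
      S * (real (Suc k) ^ d * (LINT y|lborel. g y * gauss_cart (real (Suc k) *\<^sub>R y)))" for k
  proof -
    define \<kappa> where "\<kappa> = real (Suc k)"
    have \<kappa>: "\<kappa> > 0" by (simp add: \<kappa>_def)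
    define G where "G t = gauss_cart (inverse \<kappa> *\<^sub>R t)" for t :: "real ^ 'd"
    have [measurable]: "G \<in> borel_measurable borel" unfolding G_def by measurable
    have G_hat: "(CLINT t|lborel. G t *\<^sub>R iexp (t \<bullet> y)) = complex_of_real (\<kappa> ^ d * (S * gauss_cart (\<kappa> *\<^sub>R y)))" for y
    proof -
      have "(\<lambda>t. gauss_cart t *\<^sub>R iexp (t \<bullet> (\<kappa> *\<^sub>R y))) \<in> borel_measurable borel" by measurable
      from integral_lborel_scaleR_cart[OF this \<kappa>]
      have "\<kappa> ^ d *\<^sub>R (complex_of_real S * complex_of_real (gauss_cart (\<kappa> *\<^sub>R y))) =
          (CLINT t|lborel. G t *\<^sub>R iexp ((inverse \<kappa> *\<^sub>R t) \<bullet> (\<kappa> *\<^sub>R y)))"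
        unfolding integral_gauss_cart_iexp by (simp add: G_def S_def d_def)
      moreover have "(inverse \<kappa> *\<^sub>R t) \<bullet> (\<kappa> *\<^sub>R y) = t \<bullet> y" for t using \<kappa> by simp
      ultimately show ?thesis by (simp add: scaleR_conv_of_real)
    qed
    have G_int: "integrable lborel G"
    proof -
      have "integrable lborel (\<lambda>x::real. std_normal_density (0 + inverse \<kappa> * x))"
        using \<kappa> by (intro lborel_integrable_real_affine) auto
      then have "integrable lborel (\<lambda>x::real. std_normal_density (inverse \<kappa> * x))" by simp
      from integrable_lborel_prod_cart[of "\<lambda>_ x. std_normal_density (inverse \<kappa> * x)", OF this]
      show ?thesis by (simp add: G_def[abs_def] gauss_cart_def)
    qed
    define f where "f t y = (G t * g y) *\<^sub>R iexp (t \<bullet> y)" for t y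
    have f_int: "integrable (lborel \<Otimes>\<^sub>M lborel) (\<lambda>(t, y). f t y)"
    proof (rule lborel_pair.Fubini_integrable)
      show "(\<lambda>(t, y). f t y) \<in> borel_measurable (lborel \<Otimes>\<^sub>M lborel)"
        unfolding f_def by measurable
      have "(LINT y|lborel. norm (f t y)) = G t * (LINT y|lborel. g y)" for t
        using g_nonneg by (simp add: f_def abs_mult G_def gauss_cart_nonneg)
      then show "integrable lborel (\<lambda>t. LINT y|lborel. norm (case (t, y) of (t, y) \<Rightarrow> f t y))"
        using G_int by simp
      have [measurable]: "f t \<in> borel_measurable borel" for t unfolding f_def by measurable
      have "integrable lborel (f t)" for t
        by (rule Bochner_Integration.integrable_bound[of _ "\<lambda>y. G t * g y"])
           (use g_int in \<open>auto simp: f_def\<close>)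
      then show "AE t in lborel. integrable lborel (\<lambda>y. case (t, y) of (t, y) \<Rightarrow> f t y)"
        by simp
    qed
    have "(CLINT t|lborel. G t *\<^sub>R \<psi> t) = (CLINT t|lborel. CLINT y|lborel. f t y)"
      by (simp add: psi f_def scaleR_scaleR[symmetric] del: scaleR_scaleR)
    also have "\<dots> = (CLINT y|lborel. CLINT t|lborel. f t y)"
      by (rule lborel_pair.Fubini_integral[OF f_int, symmetric])
    also have "\<dots> = (CLINT y|lborel. g y *\<^sub>R (CLINT t|lborel. G t *\<^sub>R iexp (t \<bullet> y)))"
    proof -
      have "f t y = g y *\<^sub>R (G t *\<^sub>R iexp (t \<bullet> y))" for t y
        by (simp add: f_def mult.commute)
      then show ?thesis by (simp only: integral_scaleR_right)
    qed
    also have "\<dots> = (CLINT y|lborel. complex_of_real (S * (\<kappa> ^ d * (g y * gauss_cart (\<kappa> *\<^sub>R y)))))"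
      unfolding G_hat by (intro Bochner_Integration.integral_cong refl) (simp add: scaleR_conv_of_real algebra_simps)
    also have "\<dots> = complex_of_real (S * (\<kappa> ^ d * (LINT y|lborel. g y * gauss_cart (\<kappa> *\<^sub>R y))))"
      by (simp only: integral_complex_of_real integral_mult_right_zero)
    finally show ?thesis by (simp only: G_def \<kappa>_def)
  qed
  have lim1: "(\<lambda>k. CLINT t|lborel. gauss_cart (inverse (real (Suc k)) *\<^sub>R t) *\<^sub>R \<psi> t) \<longlonglongrightarrow> (CLINT t|lborel. gauss_cart (0 :: real ^ 'd) *\<^sub>R \<psi> t)"
  proof (rule integral_dominated_convergence[where w = "\<lambda>t. gauss_cart (0 :: real ^ 'd) * cmod (\<psi> t)"])
    show "integrable lborel (\<lambda>t. gauss_cart (0 :: real ^ 'd) * cmod (\<psi> t))"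
      using psi_int by simp
    show "AE t in lborel. norm (gauss_cart (inverse (real (Suc k)) *\<^sub>R t) *\<^sub>R \<psi> t) \<le> gauss_cart (0 :: real ^ 'd) * cmod (\<psi> t)" for k
      unfolding norm_scaleR abs_of_nonneg[OF gauss_cart_nonneg]
      by (intro AE_I2 mult_right_mono gauss_cart_le norm_ge_zero)
    have "continuous_on UNIV (gauss_cart :: real ^ 'd \<Rightarrow> real)"
      unfolding gauss_cart_eq[abs_def] by (intro continuous_intros) auto
    then have c0: "isCont (gauss_cart :: real ^ 'd \<Rightarrow> real) 0" by (simp add: continuous_on_eq_continuous_at)
    have "(\<lambda>k. inverse (real (Suc k)) *\<^sub>R t) \<longlonglongrightarrow> 0 *\<^sub>R t" for t :: "real ^ 'd"
      by (intro tendsto_scaleR tendsto_const LIMSEQ_inverse_real_of_nat)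
    then have "(\<lambda>k. gauss_cart (inverse (real (Suc k)) *\<^sub>R t)) \<longlonglongrightarrow> gauss_cart (0 :: real ^ 'd)" for t :: "real ^ 'd"
      by (intro isCont_tendsto_compose[OF c0]) simp
    then show "AE t in lborel. (\<lambda>k. gauss_cart (inverse (real (Suc k)) *\<^sub>R t) *\<^sub>R \<psi> t) \<longlonglongrightarrow> gauss_cart (0 :: real ^ 'd) *\<^sub>R \<psi> t"
      by (intro AE_I2 tendsto_scaleR tendsto_const)
  qed measurable
  have lim2: "(\<lambda>k. complex_of_real (S * (real (Suc k) ^ d * (LINT y|lborel. g y * gauss_cart (real (Suc k) *\<^sub>R y))))) \<longlonglongrightarrow> complex_of_real (S * g 0)"
    using gauss_approximate_identity[OF g_nonneg g_cont g_int] unfolding d_def by (intro tendsto_of_real tendsto_mult tendsto_const)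
  have "(CLINT t|lborel. gauss_cart (0 :: real ^ 'd) *\<^sub>R \<psi> t) = complex_of_real (S * g 0)"
    using LIMSEQ_unique[OF lim1] lim2 unfolding smooth by blast
  moreover have "gauss_cart (0 :: real ^ 'd) = 1 / S"
    by (simp add: gauss_cart_eq S_def d_def power_one_over)
  ultimately have "(CLINT t|lborel. \<psi> t) = complex_of_real (S * S * g 0)"
    using S by (simp add: scaleR_conv_of_real field_simps)
  also have "S * S = (2 * pi) ^ d"
    unfolding S_def power_mult_distrib[symmetric] by simp
  finally show ?thesis by (simp add: d_def)
qed

section \<open>Random walks on the integer lattice\<close>

lemma integral_period_iexp:
  fixes k :: int
  shows "(CLINT s|lborel. indicator {-pi..pi} s *\<^sub>R iexp (s * k)) = (if k = 0 then 2 * pi else 0)"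
proof (cases "k = 0")
  case True
  then show ?thesis by (simp add: scaleR_conv_of_real)
next
  case False
  have "(CLINT s|lborel. indicator {-pi..pi} s *\<^sub>R iexp (s * k)) =
      iexp (pi * k) / (\<i> * k) - iexp (- pi * k) / (\<i> * k)"
  proof (rule integral_FTC_Icc)
    fix s :: real
    have "((\<lambda>z. exp (\<i> * z * k) / (\<i> * k)) has_field_derivative exp (\<i> * of_real s * k)) (at (of_real s))"
      using False by (auto intro!: derivative_eq_intros)
    from has_vector_derivative_real_field[OF this]
    show "((\<lambda>s. iexp (s * k) / (\<i> * k)) has_vector_derivative iexp (s * k)) (at s within {-pi..pi})"
      by (simp add: mult.assoc)
  qed (auto intro!: continuous_intros)
  also have "iexp (pi * k) = iexp (- pi * k)"
  proof -
    have "\<i> * of_real (pi * k) = \<i> * of_real (- pi * k) + 2 * of_int k * pi * \<i>"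
      by (simp add: algebra_simps)
    then have "iexp (pi * k) = iexp (- pi * k) * exp (2 * of_int k * pi * \<i>)"
      by (simp only: exp_add)
    also have "exp (2 * of_int k * pi * \<i>) = 1" by (rule exp_integer_2pi) simp
    finally show ?thesis by simp
  qed
  finally show ?thesis using False by simp
qed

text \<open>
  Orthogonality of the lattice characters on the torus.
\<close>
lemma integral_cube_iexp:
  fixes x :: "int ^ 'd"
  shows "integrable lborel (\<lambda>t. indicator (cube pi) t *\<^sub>R iexp (t \<bullet> real_vec x))"
    and "(CLINT t|lborel. indicator (cube pi) t *\<^sub>R iexp (t \<bullet> real_vec x)) = (if x = 0 then (2 * pi) ^ CARD('d) else 0)"
proof -
  have eq: "indicator (cube pi) t *\<^sub>R iexp (t \<bullet> real_vec x) = (\<Prod>r\<in>UNIV. indicator {-pi..pi} (t $ r) *\<^sub>R iexp (t $ r * (x $ r)))" for t :: "real ^ 'd"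
  proof -
    have "indicator (cube pi) t = (\<Prod>r\<in>UNIV. indicator {-pi..pi} (t $ r) :: real)"
      by (auto simp: cube_def indicator_def prod_zero_iff)
    then show ?thesis
      by (simp add: scaleR_conv_of_real prod.distrib inner_vec_def real_vec_def exp_sum[symmetric] sum_distrib_left)
  qed
  have int: "integrable lborel (\<lambda>s. indicator {-pi..pi} s *\<^sub>R iexp (s * (x $ r)))" for r
    by (rule Bochner_Integration.integrable_bound[of _ "indicator {-pi..pi} :: real \<Rightarrow> real"])
       (auto simp: indicator_def)
  show "integrable lborel (\<lambda>t. indicator (cube pi) t *\<^sub>R iexp (t \<bullet> real_vec x))"
    unfolding eq by (rule integrable_lborel_prod_cart[OF int])
  have "(CLINT t|lborel. indicator (cube pi) t *\<^sub>R iexp (t \<bullet> real_vec x)) = (\<Prod>r\<in>UNIV. complex_of_real (if x $ r = 0 then 2 * pi else 0))"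
    unfolding eq by (subst integral_lborel_prod_cart[OF int], subst integral_period_iexp, rule refl)
  also have "\<dots> = (if x = 0 then (2 * pi) ^ CARD('d) else 0)"
    by (auto simp: vec_eq_iff prod_zero_iff)
  finally show "(CLINT t|lborel. indicator (cube pi) t *\<^sub>R iexp (t \<bullet> real_vec x)) = (if x = 0 then (2 * pi) ^ CARD('d) else 0)" .
qed

lemma measurable_sum_countable:
  fixes f :: "'i \<Rightarrow> 'a \<Rightarrow> 'b::{countable,comm_monoid_add}"
  assumes "\<And>i. i \<in> I \<Longrightarrow> f i \<in> measurable M (count_space UNIV)"
  shows "(\<lambda>\<omega>. \<Sum>i\<in>I. f i \<omega>) \<in> measurable M (count_space UNIV)"
  using assms
proof (induction I rule: infinite_finite_induct)
  case (insert i I)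
  then show ?case
    by simp
qed auto

lemma real_vec_sum: "real_vec (\<Sum>i\<in>I. f i) = (\<Sum>i\<in>I. real_vec (f i))"
  by (simp add: real_vec_def vec_eq_iff)

lemma return_time_eq_enat_iff:
  "return_time X \<omega> = enat n \<longleftrightarrow> n > 0 \<and> walk X n \<omega> = 0 \<and> (\<forall>k\<in>{1..<n}. walk X k \<omega> \<noteq> 0)"
proof -
  define A where "A = {k. k > 0 \<and> walk X k \<omega> = 0}"
  have rt: "return_time X \<omega> = Inf (enat ` A)" by (simp add: return_time_def A_def)
  have "Inf (enat ` A) = enat n \<longleftrightarrow> n \<in> A \<and> (\<forall>k\<in>A. n \<le> k)"
  proof
    assume *: "Inf (enat ` A) = enat n"
    then have "A \<noteq> {}" by (auto simp: top_enat_def)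
    then have "Inf (enat ` A) \<in> enat ` A" by (auto intro: wellorder_InfI)
    then have "n \<in> A" using * by auto
    moreover have "enat n \<le> enat k" if "k \<in> A" for k
      unfolding *[symmetric] using that by (intro Inf_lower) auto
    ultimately show "n \<in> A \<and> (\<forall>k\<in>A. n \<le> k)" by auto
  next
    assume "n \<in> A \<and> (\<forall>k\<in>A. n \<le> k)"
    then show "Inf (enat ` A) = enat n"
      by (intro antisym Inf_lower Inf_greatest) auto
  qed
  then show ?thesis
    unfolding rt by (auto simp: A_def Suc_le_eq not_le)
qed

locale iid_walk = prob_space M for M :: "'a measure" +
  fixes X :: "nat \<Rightarrow> 'a \<Rightarrow> int ^ 'd"
  assumes iid: "iid_steps M X"
begin

definition step_char :: "real ^ 'd \<Rightarrow> complex" where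
  "step_char t = (CLINT \<omega>|M. iexp (t \<bullet> real_vec (X 1 \<omega>)))"

lemma indep_steps: "indep_vars (\<lambda>_. count_space UNIV) X {1..}"
  using iid unfolding iid_steps_def by blast

lemma measurable_step [measurable]: "n \<ge> 1 \<Longrightarrow> X n \<in> measurable M (count_space UNIV)"
  using indep_steps by (simp add: indep_vars_def)

lemma measurable_step_sum: "I \<subseteq> {1..} \<Longrightarrow> (\<lambda>\<omega>. \<Sum>i\<in>I. X i \<omega>) \<in> measurable M (count_space UNIV)"
  by (intro measurable_sum_countable measurable_step) auto

lemma measurable_walk [measurable]: "walk X n \<in> measurable M (count_space UNIV)"
  unfolding walk_def[abs_def] by (rule measurable_step_sum) auto

lemma measurable_real_vec: "f \<in> measurable M (count_space UNIV) \<Longrightarrow> (\<lambda>\<omega>. real_vec (f \<omega>) :: real ^ 'd) \<in> borel_measurable M"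
  by (rule measurable_compose[of f M "count_space UNIV"]) auto

lemma char_step_sum:
  assumes I: "finite I" "I \<subseteq> {1..}"
  shows "(CLINT \<omega>|M. iexp (t \<bullet> real_vec (\<Sum>i\<in>I. X i \<omega>))) = step_char t ^ card I"
proof -
  have int: "integrable M (\<lambda>\<omega>. iexp (t \<bullet> real_vec (X i \<omega>)))" if "i \<in> I" for i
  proof (rule integrable_const_bound[of _ 1])
    have "(\<lambda>\<omega>. real_vec (X i \<omega>)) \<in> borel_measurable M"
      using that I by (intro measurable_real_vec measurable_step) auto
    then show "(\<lambda>\<omega>. iexp (t \<bullet> real_vec (X i \<omega>))) \<in> borel_measurable M" by measurable
  qed auto
  have same: "(CLINT \<omega>|M. iexp (t \<bullet> real_vec (X i \<omega>))) = step_char t" if "i \<in> I" for i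
  proof -
    have "i \<ge> 1" using that I by auto
    have "(CLINT \<omega>|M. iexp (t \<bullet> real_vec (X i \<omega>))) = (CLINT x|distr M (count_space UNIV) (X i). iexp (t \<bullet> real_vec x))"
      using \<open>i \<ge> 1\<close> by (intro integral_distr[symmetric]) auto
    also have "distr M (count_space UNIV) (X i) = distr M (count_space UNIV) (X 1)"
      using iid \<open>i \<ge> 1\<close> unfolding iid_steps_def by blast
    also have "(CLINT x|distr M (count_space UNIV) (X 1). iexp (t \<bullet> real_vec x)) = step_char t"
      unfolding step_char_def by (intro integral_distr) auto
    finally show ?thesis .
  qed
  have indep: "indep_vars (\<lambda>_. borel) (\<lambda>i \<omega>. iexp (t \<bullet> real_vec (X i \<omega>))) I"
    by (rule indep_vars_compose2[OF indep_vars_subset[OF indep_steps I(2)]]) auto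
  have "(CLINT \<omega>|M. iexp (t \<bullet> real_vec (\<Sum>i\<in>I. X i \<omega>))) = (CLINT \<omega>|M. \<Prod>i\<in>I. iexp (t \<bullet> real_vec (X i \<omega>)))"
    using I(1) by (simp add: real_vec_sum inner_sum_right sum_distrib_left exp_sum)
  also have "\<dots> = (\<Prod>i\<in>I. step_char t)"
    by (subst indep_vars_lebesgue_integral[OF I(1) indep int]) (auto simp: same)
  finally show ?thesis by simp
qed

lemma measurable_step_char [measurable]: "step_char \<in> borel_measurable borel"
proof -
  have [measurable]: "(\<lambda>\<omega>. real_vec (X 1 \<omega>)) \<in> borel_measurable M"
    by (intro measurable_real_vec measurable_step) simp
  have "(\<lambda>t. CLINT \<omega>|M. iexp (t \<bullet> real_vec (X 1 \<omega>))) \<in> borel_measurable (borel :: (real ^ 'd) measure)"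
    by measurable
  then show ?thesis by (simp add: step_char_def[abs_def])
qed

lemma step_char_tendsto_1:
  assumes "w \<longlonglongrightarrow> 0"
  shows "(\<lambda>n. step_char (w n)) \<longlonglongrightarrow> 1"
proof -
  have [measurable]: "(\<lambda>\<omega>. real_vec (X 1 \<omega>)) \<in> borel_measurable M"
    by (intro measurable_real_vec measurable_step) simp
  have "(\<lambda>n. step_char (w n)) \<longlonglongrightarrow> (CLINT \<omega>|M. 1)"
    unfolding step_char_def
  proof (rule integral_dominated_convergence[where w = "\<lambda>_. 1"])
    have "(\<lambda>n. iexp (w n \<bullet> x)) \<longlonglongrightarrow> iexp (0 \<bullet> x)" for x :: "real ^ 'd"
      by (intro tendsto_intros assms)
    then show "AE \<omega> in M. (\<lambda>n. iexp (w n \<bullet> real_vec (X 1 \<omega>))) \<longlonglongrightarrow> 1" by simp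
  qed auto
  then show ?thesis by (simp add: prob_space)
qed

lemma norm_step_char: "cmod (step_char t) \<le> 1"
proof -
  have "cmod (step_char t) \<le> (LINT \<omega>|M. cmod (iexp (t \<bullet> real_vec (X 1 \<omega>))))"
    unfolding step_char_def by (rule integral_norm_bound)
  then show ?thesis by (simp add: prob_space)
qed

lemma step_char_period: "step_char (axis r (2 * pi * of_int j)) = 1"
proof -
  have "iexp (axis r (2 * pi * of_int j) \<bullet> real_vec x) = 1" for x :: "int ^ 'd"
  proof -
    have "\<i> * complex_of_real (axis r (2 * pi * of_int j) \<bullet> real_vec x) = 2 * of_int (j * x $ r) * pi * \<i>"
      by (simp add: inner_axis' real_vec_def)
    also have "exp \<dots> = 1" by (rule exp_integer_2pi) simp
    finally show ?thesis .
  qed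
  then show ?thesis by (simp add: step_char_def prob_space)
qed

text \<open>
  Lattice inversion at 0, for an arbitrary set of steps: the indicator of \<open>S = 0\<close> is an average of characters of \<open>S\<close>, and
  independence turns their expectations into powers of \<open>step_char\<close>. The right-hand side depends on the set only
  through its cardinality, which yields the stationarity of the walk in \<open>step_sum_zero_prob_card\<close>.
\<close>
theorem step_sum_zero_prob:
  assumes I: "finite I" "I \<subseteq> {1..}"
  shows "complex_of_real ((2 * pi) ^ CARD('d) * prob {\<omega> \<in> space M. (\<Sum>i\<in>I. X i \<omega>) = 0}) =
    (CLINT t|lborel. indicator (cube pi) t *\<^sub>R step_char t ^ card I)"
proof -
  interpret P: pair_sigma_finite M "lborel :: (real ^ 'd) measure" ..
  define S where "S \<omega> = (\<Sum>i\<in>I. X i \<omega>)" for \<omega>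
  have S[measurable]: "S \<in> measurable M (count_space UNIV)"
    unfolding S_def[abs_def] by (rule measurable_step_sum[OF I(2)])
  have [measurable]: "(\<lambda>\<omega>. real_vec (S \<omega>)) \<in> borel_measurable M"
    by (rule measurable_real_vec[OF S])
  define f where "f \<omega> t = indicator (cube pi) t *\<^sub>R iexp (t \<bullet> real_vec (S \<omega>))" for \<omega> t
  have f_int: "integrable (M \<Otimes>\<^sub>M lborel) (\<lambda>(\<omega>, t). f \<omega> t)"
  proof (rule P.Fubini_integrable)
    show "(\<lambda>(\<omega>, t). f \<omega> t) \<in> borel_measurable (M \<Otimes>\<^sub>M lborel)"
      unfolding f_def by measurable
    show "integrable M (\<lambda>\<omega>. LINT t|lborel. norm (case (\<omega>, t) of (\<omega>, t) \<Rightarrow> f \<omega> t))"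
      by (simp add: f_def)
    show "AE \<omega> in M. integrable lborel (\<lambda>t. case (\<omega>, t) of (\<omega>, t) \<Rightarrow> f \<omega> t)"
      unfolding f_def by (simp add: integral_cube_iexp(1))
  qed
  have "complex_of_real ((2 * pi) ^ CARD('d) * prob {\<omega> \<in> space M. S \<omega> = 0}) =
      (CLINT \<omega>|M. complex_of_real ((2 * pi) ^ CARD('d) * indicator {\<omega> \<in> space M. S \<omega> = 0} \<omega>))"
    by (simp add: integral_complex_of_real del: of_real_mult)
  also have "\<dots> = (CLINT \<omega>|M. CLINT t|lborel. f \<omega> t)"
    unfolding f_def integral_cube_iexp(2)
    by (intro Bochner_Integration.integral_cong refl) (auto simp: indicator_def)
  also have "\<dots> = (CLINT t|lborel. CLINT \<omega>|M. f \<omega> t)"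
    by (rule P.Fubini_integral[OF f_int, symmetric])
  also have "\<dots> = (CLINT t|lborel. indicator (cube pi) t *\<^sub>R step_char t ^ card I)"
    unfolding f_def S_def by (simp add: char_step_sum[OF I])
  finally show ?thesis by (simp add: S_def)
qed

lemma step_sum_zero_prob_card:
  assumes "finite I" "I \<subseteq> {1..}"
  shows "prob {\<omega> \<in> space M. (\<Sum>i\<in>I. X i \<omega>) = 0} = prob {\<omega> \<in> space M. walk X (card I) \<omega> = 0}"
proof -
  have "complex_of_real ((2 * pi) ^ CARD('d) * prob {\<omega> \<in> space M. (\<Sum>i\<in>I. X i \<omega>) = 0}) =
    complex_of_real ((2 * pi) ^ CARD('d) * prob {\<omega> \<in> space M. walk X (card I) \<omega> = 0})"
    using step_sum_zero_prob[OF assms] step_sum_zero_prob[of "{1..card I}"] by (simp add: walk_def)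
  then show ?thesis by (simp only: of_real_eq_iff) simp
qed

definition return_at :: "nat \<Rightarrow> real" where
  "return_at n = prob {\<omega> \<in> space M. return_time X \<omega> = enat n}"

definition at_origin :: "nat \<Rightarrow> real" where
  "at_origin n = prob {\<omega> \<in> space M. walk X n \<omega> = 0}"

lemma measurable_return_time: "{\<omega> \<in> space M. return_time X \<omega> = enat n} \<in> events"
  unfolding return_time_eq_enat_iff by measurable

text \<open>
  The event of a first return at time \<open>k\<close> is a function \<open>T\<close> of the steps up to \<open>k\<close>; on it, \<open>walk X n = 0\<close> means
  that the later steps, which are independent of it, sum to 0.
\<close>
lemma return_at_then_origin:
  assumes "k \<le> n"
  shows "prob {\<omega> \<in> space M. return_time X \<omega> = enat k \<and> walk X n \<omega> = 0} = return_at k * at_origin (n - k)"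
proof -
  define A where "A = {1..k}"
  define B where "B = {k+1..n}"
  have AB: "A \<inter> B = {}" "A \<subseteq> {1..}" "B \<subseteq> {1..}" by (auto simp: A_def B_def)
  define S where "S j x = (\<Sum>i\<in>{1..j}. x i)" for j and x :: "nat \<Rightarrow> int ^ 'd"
  define T where "T x \<longleftrightarrow> k > 0 \<and> S k x = 0 \<and> (\<forall>j\<in>{1..<k}. S j x \<noteq> 0)" for x
  define R where "R x \<longleftrightarrow> (\<Sum>i\<in>B. x i) = 0" for x :: "nat \<Rightarrow> int ^ 'd"
  have S_meas: "S j \<in> measurable (PiM A (\<lambda>_. count_space UNIV)) (count_space UNIV)" if "j \<le> k" for j
    unfolding S_def using that by (intro measurable_sum_countable measurable_component_singleton) (auto simp: A_def)
  have T_meas: "T \<in> measurable (PiM A (\<lambda>_. count_space UNIV)) (count_space UNIV)"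
  proof -
    have [measurable]: "Measurable.pred (PiM A (\<lambda>_. count_space UNIV)) (\<lambda>x. S j x = 0)" if "j \<le> k" for j
      using measurable_compose[OF S_meas[OF that], of "\<lambda>y. y = 0"] by simp
    show ?thesis unfolding T_def by (measurable) auto
  qed
  have R_meas: "R \<in> measurable (PiM B (\<lambda>_. count_space UNIV)) (count_space UNIV)"
  proof -
    have "(\<lambda>x. \<Sum>i\<in>B. x i) \<in> measurable (PiM B (\<lambda>_. count_space UNIV)) (count_space (UNIV :: (int ^ 'd) set))"
      by (intro measurable_sum_countable measurable_component_singleton)
    from measurable_compose[OF this, of "\<lambda>y. y = 0"] show ?thesis by (simp add: R_def[abs_def])
  qed
  have TA: "T (restrict (\<lambda>i. X i \<omega>) A) \<longleftrightarrow> return_time X \<omega> = enat k" for \<omega>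
  proof -
    have "S j (restrict (\<lambda>i. X i \<omega>) A) = walk X j \<omega>" if "j \<le> k" for j
      unfolding S_def walk_def using that by (intro sum.cong) (auto simp: A_def)
    then show ?thesis by (auto simp: T_def return_time_eq_enat_iff)
  qed
  have RB: "R (restrict (\<lambda>i. X i \<omega>) B) \<longleftrightarrow> (\<Sum>i\<in>B. X i \<omega>) = 0" for \<omega>
    by (simp add: R_def)
  have "indep_var (count_space UNIV) (T \<circ> (\<lambda>\<omega>. restrict (\<lambda>i. X i \<omega>) A)) (count_space UNIV) (R \<circ> (\<lambda>\<omega>. restrict (\<lambda>i. X i \<omega>) B))"
    by (rule indep_var_compose[OF indep_var_restrict[OF indep_steps AB] T_meas R_meas])
  from indep_varD[OF this, of "{True}" "{True}"]
  have "prob {\<omega> \<in> space M. return_time X \<omega> = enat k \<and> (\<Sum>i\<in>B. X i \<omega>) = 0} =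
    return_at k * prob {\<omega> \<in> space M. (\<Sum>i\<in>B. X i \<omega>) = 0}"
    by (simp add: TA RB vimage_def Int_def conj_commute return_at_def)
  also have "prob {\<omega> \<in> space M. (\<Sum>i\<in>B. X i \<omega>) = 0} = at_origin (n - k)"
    using step_sum_zero_prob_card[of B] AB by (simp add: B_def at_origin_def)
  also have "{\<omega> \<in> space M. return_time X \<omega> = enat k \<and> (\<Sum>i\<in>B. X i \<omega>) = 0} = {\<omega> \<in> space M. return_time X \<omega> = enat k \<and> walk X n \<omega> = 0}"
  proof -
    have "walk X n \<omega> = walk X k \<omega> + (\<Sum>i\<in>B. X i \<omega>)" for \<omega>
      unfolding walk_def B_def using assms by (subst sum.union_disjoint[symmetric]) (auto intro!: sum.cong)
    then show ?thesis by (auto simp: return_time_eq_enat_iff)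
  qed
  finally show ?thesis .
qed

theorem renewal_equation:
  assumes "n > 0"
  shows "at_origin n = (\<Sum>k\<le>n. return_at k * at_origin (n - k))"
proof -
  define E where "E k = {\<omega> \<in> space M. return_time X \<omega> = enat k \<and> walk X n \<omega> = 0}" for k
  have E: "E k \<in> events" for k
    unfolding E_def using measurable_return_time[of k] by measurable
  have "{\<omega> \<in> space M. walk X n \<omega> = 0} = (\<Union>k\<le>n. E k)"
  proof (intro equalityI subsetI)
    fix \<omega> assume *: "\<omega> \<in> {\<omega> \<in> space M. walk X n \<omega> = 0}"
    define k where "k = (LEAST k. k > 0 \<and> walk X k \<omega> = 0)"
    have "k > 0 \<and> walk X k \<omega> = 0" unfolding k_def by (rule LeastI[of _ n]) (use * assms in auto)
    moreover have "k \<le> n" unfolding k_def by (rule Least_le) (use * assms in auto)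
    moreover have "walk X j \<omega> \<noteq> 0" if "j \<in> {1..<k}" for j
      using not_less_Least[of j "\<lambda>k. k > 0 \<and> walk X k \<omega> = 0"] that by (auto simp: k_def)
    ultimately show "\<omega> \<in> (\<Union>k\<le>n. E k)"
      using * by (auto simp: E_def return_time_eq_enat_iff intro!: bexI[of _ k])
  qed (auto simp: E_def)
  then have "at_origin n = prob (\<Union>k\<le>n. E k)" by (simp add: at_origin_def)
  also have "\<dots> = (\<Sum>k\<le>n. prob (E k))"
    by (rule finite_measure_finite_Union) (auto simp: disjoint_family_on_def E_def intro: E[unfolded E_def])
  also have "\<dots> = (\<Sum>k\<le>n. return_at k * at_origin (n - k))"
    by (intro sum.cong refl) (simp add: E_def return_at_then_origin)
  finally show ?thesis .
qed

lemma return_at_sums: "return_at sums return_prob M X"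
proof -
  have "(\<lambda>n. return_at n) sums prob (\<Union>n. {\<omega> \<in> space M. return_time X \<omega> = enat n})"
    unfolding return_at_def using measurable_return_time
    by (intro finite_measure_UNION) (auto simp: disjoint_family_on_def)
  moreover have "(\<Union>n. {\<omega> \<in> space M. return_time X \<omega> = enat n}) = {\<omega> \<in> space M. return_time X \<omega> < \<infinity>}"
    by (auto elim!: less_infinityE)
  ultimately show ?thesis by (simp add: return_prob_def)
qed

lemma at_origin_0: "at_origin 0 = 1"
  by (simp add: at_origin_def walk_def prob_space)

lemma return_at_0: "return_at 0 = 0"
  by (simp add: return_at_def return_time_eq_enat_iff)

end

section \<open>First returns of an asymptotically stable walk\<close>

lemma distributed_real_density:
  fixes Y :: "'b \<Rightarrow> real ^ 'd" and g :: "real ^ 'd \<Rightarrow> real"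
  assumes "prob_space N" and Y: "distributed N lborel Y (\<lambda>y. ennreal (g y))"
    and [measurable]: "Y \<in> borel_measurable N" and g: "\<And>y. g y \<ge> 0" "continuous_on UNIV g"
  shows "integrable lborel g"
    and "(CLINT \<omega>|N. iexp (t \<bullet> Y \<omega>)) = (CLINT y|lborel. g y *\<^sub>R iexp (t \<bullet> y))"
proof -
  interpret prob_space N by fact
  have [measurable]: "g \<in> borel_measurable borel" using g(2) by (rule borel_measurable_continuous_onI)
  show "integrable lborel g"
    using distributed_integrable[OF Y, of "\<lambda>_. 1"] g(1) by simp
  have "(CLINT \<omega>|N. iexp (t \<bullet> Y \<omega>)) = (CLINT y|distr N lborel Y. iexp (t \<bullet> y))"
    by (intro integral_distr[symmetric]) auto
  also have "distr N lborel Y = density lborel (\<lambda>y. ennreal (g y))"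
    using Y by (simp add: distributed_def)
  also have "(CLINT y|density lborel (\<lambda>y. ennreal (g y)). iexp (t \<bullet> y)) = (CLINT y|lborel. g y *\<^sub>R iexp (t \<bullet> y))"
    using g(1) by (intro integral_density) auto
  finally show "(CLINT \<omega>|N. iexp (t \<bullet> Y \<omega>)) = (CLINT y|lborel. g y *\<^sub>R iexp (t \<bullet> y))" .
qed

lemma (in iid_walk) aperiodic_step_char:
  assumes "aperiodic M X" "\<epsilon> > 0"
  shows "\<exists>\<theta><1. \<forall>t\<in>cube pi - cube \<epsilon>. cmod (step_char t) \<le> \<theta>"
proof (cases "cube pi - cube \<epsilon> = ({} :: (real ^ 'd) set)")
  case True
  show ?thesis unfolding True by (intro exI[of _ 0]) simp
next
  case False
  define \<theta> where "\<theta> = (SUP t\<in>cube pi - cube \<epsilon>. cmod (step_char t))"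
  have "\<theta> < 1" using assms False by (auto simp: aperiodic_def \<theta>_def step_char_def)
  moreover have "cmod (step_char t) \<le> \<theta>" if "t \<in> cube pi - cube \<epsilon>" for t
    unfolding \<theta>_def using that norm_step_char by (intro cSUP_upper bdd_aboveI[of _ 1]) auto
  ultimately show ?thesis by blast
qed

text \<open>
  The setting of the local limit theorem. Transience and positivity of the density at the origin are added in
  \<open>first_return_asymptotics\<close>, where the renewal equation comes in.
\<close>
locale stable_walk = iid_walk M X + limit: prob_space N
  for M :: "'a measure" and X :: "nat \<Rightarrow> 'a \<Rightarrow> int ^ 'd" and N :: "'b measure" +
  fixes c :: "nat \<Rightarrow> real ^ 'd" and Y :: "'b \<Rightarrow> real ^ 'd" and g :: "real ^ 'd \<Rightarrow> real"
  assumes aperiodic: "aperiodic M X"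
    and Y_meas [measurable]: "Y \<in> borel_measurable N"
    and norming_pos: "n \<ge> 1 \<Longrightarrow> c n $ r > 0"
    and convergence: "conv_in_distribution M (\<lambda>n \<omega>. \<chi> r. real_vec (walk X n \<omega>) $ r / c n $ r) N Y"
    and Y_density: "distributed N lborel Y (\<lambda>y. ennreal (g y))"
    and g_nonneg: "g y \<ge> 0" and g_cont: "continuous_on UNIV g"
begin

definition limit_char :: "real ^ 'd \<Rightarrow> complex" where
  "limit_char t = (CLINT \<omega>|N. iexp (t \<bullet> Y \<omega>))"

lemma scaled_char: "(CLINT \<omega>|M. iexp (t \<bullet> cdiv (real_vec (walk X n \<omega>)) (c n))) = step_char (cdiv t (c n)) ^ n"
proof -
  have "t \<bullet> cdiv x (c n) = cdiv t (c n) \<bullet> x" for x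
    by (simp add: inner_vec_def)
  then show ?thesis
    using char_step_sum[of "{1..n}" "cdiv t (c n)"] by (simp add: walk_def)
qed

sublocale scaled_char_functions step_char limit_char c
proof
  show "n \<ge> 1 \<Longrightarrow> c n $ r > 0" for n r by (rule norming_pos)
  show "cmod (step_char t) \<le> 1" for t by (rule norm_step_char)
  show "step_char \<in> borel_measurable borel" by measurable
  show "step_char (axis r (2 * pi * of_int j)) = 1" for r j by (rule step_char_period)
  show "\<epsilon> > 0 \<Longrightarrow> \<exists>\<theta><1. \<forall>t\<in>cube pi - cube \<epsilon>. cmod (step_char t) \<le> \<theta>" for \<epsilon>
    by (rule aperiodic_step_char[OF aperiodic])
  show "s \<noteq> 0 \<Longrightarrow> cmod (limit_char s) < 1" for s
    unfolding limit_char_def by (rule char_vec_lt_1[OF limit.prob_space_axioms Y_meas Y_density])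
  show "limit_char 0 = 1" by (simp add: limit_char_def limit.prob_space)
  show "(\<lambda>k. step_char (cdiv (w k) (c (m k))) ^ m k) \<longlonglongrightarrow> limit_char s"
    if "filterlim m at_top sequentially" "w \<longlonglongrightarrow> s" for m w s
  proof -
    have [measurable]: "(\<lambda>\<omega>. real_vec (walk X n \<omega>)) \<in> borel_measurable M" for n
      by (rule measurable_real_vec[OF measurable_walk])
    define Z where "Z n \<omega> = cdiv (real_vec (walk X n \<omega>)) (c n)" for n \<omega>
    have "Z n \<in> borel_measurable M" for n
      unfolding Z_def cdiv_def by measurable
    moreover have "conv_in_distribution M Z N Y"
      using convergence by (simp add: Z_def[abs_def] cdiv_def)
    ultimately have "(\<lambda>k. CLINT \<omega>|M. iexp (w k \<bullet> Z (m k) \<omega>)) \<longlonglongrightarrow> (CLINT \<omega>|N. iexp (s \<bullet> Y \<omega>))"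
      by (rule char_vec_continuous_convergence[OF prob_space_axioms limit.prob_space_axioms _ Y_meas _ that])
    then show ?thesis by (simp only: Z_def scaled_char limit_char_def)
  qed
qed

lemma at_origin_fourier:
  "complex_of_real ((2 * pi) ^ CARD('d) * at_origin n) = (CLINT t|lborel. indicator (cube pi) t *\<^sub>R step_char t ^ n)"
  using step_sum_zero_prob[of "{1..n}"] by (simp add: at_origin_def walk_def)

lemma integral_limit_char: "(CLINT t|lborel. limit_char t) = (2 * pi) ^ CARD('d) * g 0"
proof (rule fourier_inversion_at_0[OF g_nonneg g_cont])
  show "integrable lborel g"
    by (rule distributed_real_density(1)[OF limit.prob_space_axioms Y_density Y_meas g_nonneg g_cont])
  show "limit_char t = (CLINT y|lborel. g y *\<^sub>R iexp (t \<bullet> y))" for t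
    unfolding limit_char_def
    by (rule distributed_real_density(2)[OF limit.prob_space_axioms Y_density Y_meas g_nonneg g_cont])
  show "integrable lborel limit_char"
    by (rule scaled_integral_tendsto(1)[of "\<lambda>_. 1" 1 1]) auto
qed

definition norming_prod :: "nat \<Rightarrow> real" where
  "norming_prod n = (\<Prod>r\<in>UNIV. c n $ r)"

lemma norming_prod_pos: "n \<ge> 1 \<Longrightarrow> norming_prod n > 0"
  unfolding norming_prod_def by (intro prod_pos norming_pos) auto

theorem local_limit: "(\<lambda>n. norming_prod n * at_origin n) \<longlonglongrightarrow> g 0"
proof -
  define P where "P = (2 * pi) ^ CARD('d)"
  have P: "P > 0" by (simp add: P_def)
  have "(\<lambda>n. norming_prod n *\<^sub>R (CLINT t|lborel. indicator (cube pi) t *\<^sub>R (step_char t ^ n * 1))) \<longlonglongrightarrow> (CLINT t|lborel. limit_char t * 1)"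
    unfolding norming_prod_def by (rule scaled_integral_tendsto(2)[of "\<lambda>_. 1" 1 1]) auto
  moreover have "norming_prod n *\<^sub>R (CLINT t|lborel. indicator (cube pi) t *\<^sub>R (step_char t ^ n * 1)) = complex_of_real (P * (norming_prod n * at_origin n))" for n
    unfolding mult_1_right at_origin_fourier[symmetric] P_def[symmetric]
    by (simp only: scaleR_conv_of_real of_real_mult[symmetric] mult.left_commute)
  moreover have "(CLINT t|lborel. limit_char t * 1) = complex_of_real (P * g 0)"
    by (simp add: integral_limit_char P_def)
  ultimately have "(\<lambda>n. P * (norming_prod n * at_origin n)) \<longlonglongrightarrow> P * g 0"
    by (simp only: tendsto_of_real_iff)
  from tendsto_divide[OF this tendsto_const, of P] P show ?thesis by simp
qed

text \<open>
  The additional factor \<open>1 - \<phi> (t / c n)\<close> in the Fourier integral tends to 0 because \<open>t / c n\<close> does.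
\<close>
lemma at_origin_increment: "(\<lambda>n. norming_prod n * (at_origin n - at_origin (Suc n))) \<longlonglongrightarrow> 0"
proof -
  define P where "P = (2 * pi) ^ CARD('d)"
  have P: "P > 0" by (simp add: P_def)
  have "(\<lambda>n. norming_prod n *\<^sub>R (CLINT t|lborel. indicator (cube pi) t *\<^sub>R (step_char t ^ n * (1 - step_char t)))) \<longlonglongrightarrow> (CLINT t|lborel. limit_char t * 0)"
    unfolding norming_prod_def
  proof (rule scaled_integral_tendsto(2)[of "\<lambda>t. 1 - step_char t" 2 0])
    show "cmod (1 - step_char t) \<le> 2" for t
      using norm_triangle_ineq4[of 1 "step_char t"] norm_step_char[of t] by simp
    have "(\<lambda>n. cdiv t (c n)) \<longlonglongrightarrow> 0" for t
    proof (rule vec_tendstoI)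
      fix r
      have "(\<lambda>n. t $ r / c n $ r) \<longlonglongrightarrow> 0"
        using c_at_top by (intro tendsto_divide_0[OF tendsto_const] filterlim_at_top_imp_at_infinity)
      then show "(\<lambda>n. cdiv t (c n) $ r) \<longlonglongrightarrow> 0 $ r" by simp
    qed
    then have "(\<lambda>n. 1 - step_char (cdiv t (c n))) \<longlonglongrightarrow> 1 - 1" for t
      by (intro tendsto_diff tendsto_const step_char_tendsto_1)
    then show "(\<lambda>n. 1 - step_char (cdiv t (c n))) \<longlonglongrightarrow> 0" for t by simp
  qed measurable
  moreover have "(CLINT t|lborel. indicator (cube pi) t *\<^sub>R (step_char t ^ n * (1 - step_char t))) = complex_of_real (P * (at_origin n - at_origin (Suc n)))" for n
  proof -
    have int: "integrable lborel (\<lambda>t. indicator (cube pi) t *\<^sub>R step_char t ^ k)" for k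
    proof (rule Bochner_Integration.integrable_bound)
      have "cube pi = (cbox (\<chi> r. -pi) (\<chi> r. pi) :: (real ^ 'd) set)" by (auto simp: cube_def mem_box_cart)
      then show "integrable lborel (indicator (cube pi) :: real ^ 'd \<Rightarrow> real)"
        by (simp only:) (intro integrable_real_indicator emeasure_lborel_cbox_finite, simp)
      show "AE t in lborel. norm (indicator (cube pi) t *\<^sub>R step_char t ^ k) \<le> norm (indicator (cube pi) t :: real)"
        using norm_step_char by (auto simp: norm_power indicator_def power_le_one)
    qed measurable
    have "(CLINT t|lborel. indicator (cube pi) t *\<^sub>R (step_char t ^ n * (1 - step_char t))) =
      (CLINT t|lborel. indicator (cube pi) t *\<^sub>R step_char t ^ n - indicator (cube pi) t *\<^sub>R step_char t ^ Suc n)"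
      by (intro Bochner_Integration.integral_cong refl) (simp add: algebra_simps)
    also have "\<dots> = complex_of_real (P * at_origin n) - complex_of_real (P * at_origin (Suc n))"
      unfolding P_def at_origin_fourier by (rule Bochner_Integration.integral_diff[OF int int])
    finally show ?thesis by (simp add: right_diff_distrib)
  qed
  ultimately have "(\<lambda>n. complex_of_real (norming_prod n * (P * (at_origin n - at_origin (Suc n))))) \<longlonglongrightarrow> complex_of_real 0"
    by (simp add: scaleR_conv_of_real)
  then have "(\<lambda>n. norming_prod n * (P * (at_origin n - at_origin (Suc n)))) \<longlonglongrightarrow> 0"
    by (simp only: tendsto_of_real_iff)
  from tendsto_divide[OF this tendsto_const, of P] P show ?thesis by (simp add: mult.left_commute)
qed

lemma norming_prod_doubling:
  obtains K n0 where "K > 0" "n0 \<ge> 1" "\<And>m n. n0 \<le> m \<Longrightarrow> m \<le> n \<Longrightarrow> n \<le> 2 * m \<Longrightarrow> norming_prod n \<le> K * norming_prod m"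
proof -
  obtain K n0 where K: "K > 1" "n0 \<ge> 1"
    "\<And>m n r. n0 \<le> m \<Longrightarrow> m \<le> n \<Longrightarrow> n \<le> 2 * m + 1 \<Longrightarrow> c n $ r \<le> K * c m $ r"
    by (rule c_doubling) (rule that)
  have "norming_prod n \<le> K ^ CARD('d) * norming_prod m" if "n0 \<le> m" "m \<le> n" "n \<le> 2 * m" for m n
  proof -
    have "norming_prod n \<le> (\<Prod>r\<in>(UNIV :: 'd set). K * c m $ r)"
      unfolding norming_prod_def using K that norming_pos[of n] by (intro prod_mono) (auto simp: less_imp_le)
    then show ?thesis by (simp add: prod.distrib norming_prod_def)
  qed
  then show thesis using K by (intro that[of "K ^ CARD('d)" n0]) auto
qed

text \<open>
  The hypotheses of \<open>renewal_ratio\<close> follow from \<open>local_limit\<close>: since \<open>g 0 > 0\<close>, \<open>at_origin n\<close> is comparable to the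
  reciprocal of \<open>norming_prod n\<close>, so that increments are relatively small and doubling is inherited.
\<close>
theorem first_return_asymptotics:
  assumes "g 0 \<noteq> 0" and "return_prob M X < 1"
  shows "(\<lambda>n. return_at n / at_origin n) \<longlonglongrightarrow> (1 - return_prob M X)\<^sup>2"
proof -
  have g0: "g 0 > 0" using assms(1) g_nonneg[of 0] by simp
  have lower: "\<forall>\<^sub>F n in sequentially. g 0 / 2 < norming_prod n * at_origin n"
    using order_tendstoD(1)[OF local_limit, of "g 0 / 2"] g0 by simp
  have upper: "\<forall>\<^sub>F n in sequentially. norming_prod n * at_origin n < 2 * g 0"
    using order_tendstoD(2)[OF local_limit, of "2 * g 0"] g0 by simp
  have pos: "\<forall>\<^sub>F n in sequentially. at_origin n > 0"
    using lower eventually_ge_at_top[of 1]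
  proof eventually_elim
    case (elim n)
    then have "0 < norming_prod n * at_origin n" using g0 by linarith
    then show ?case using norming_prod_pos[of n] elim by (simp add: zero_less_mult_iff)
  qed
  have "(\<lambda>n. 1 - (norming_prod n * (at_origin n - at_origin (Suc n))) / (norming_prod n * at_origin n)) \<longlonglongrightarrow> 1 - 0 / g 0"
    by (intro tendsto_diff tendsto_const tendsto_divide at_origin_increment local_limit) (use g0 in auto)
  moreover have "\<forall>\<^sub>F n in sequentially. 1 - (norming_prod n * (at_origin n - at_origin (Suc n))) / (norming_prod n * at_origin n) = at_origin (Suc n) / at_origin n"
    using pos eventually_ge_at_top[of 1]
  proof eventually_elim
    case (elim n)
    then show ?case using norming_prod_pos[of n] by (simp add: field_simps)
  qed
  ultimately have ratio: "(\<lambda>n. at_origin (Suc n) / at_origin n) \<longlonglongrightarrow> 1"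
    using Lim_transform_eventually by fastforce
  obtain K n0 where K: "K > 0" "n0 \<ge> 1" "\<And>m n. n0 \<le> m \<Longrightarrow> m \<le> n \<Longrightarrow> n \<le> 2 * m \<Longrightarrow> norming_prod n \<le> K * norming_prod m"
    by (rule norming_prod_doubling) (rule that)
  obtain n1 where n1: "\<And>n. n \<ge> n1 \<Longrightarrow> g 0 / 2 < norming_prod n * at_origin n" "\<And>n. n \<ge> n1 \<Longrightarrow> norming_prod n * at_origin n < 2 * g 0"
    using eventually_conj[OF lower upper] by (auto simp: eventually_sequentially)
  \<comment> \<open>The factor 4 comes from the bounds \<open>g 0 / 2\<close> and \<open>2 * g 0\<close>.\<close>
  have doubling: "\<forall>\<^sub>F n in sequentially. \<forall>m. m \<le> n \<and> n \<le> 2 * m \<longrightarrow> at_origin m \<le> 4 * K * at_origin n"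
    using eventually_ge_at_top[of "2 * (n0 + n1)"]
  proof eventually_elim
    case (elim n)
    show ?case
    proof (intro allI impI)
      fix m assume m: "m \<le> n \<and> n \<le> 2 * m"
      have mn: "n0 \<le> m" "n1 \<le> m" "n1 \<le> n" "m \<ge> 1" using m elim K(2) by auto
      have u: "0 \<le> at_origin n" "0 \<le> at_origin m" by (auto simp: at_origin_def)
      have "norming_prod m * at_origin m \<le> 4 * (norming_prod n * at_origin n)"
        using n1(1)[of n] n1(2)[of m] mn by linarith
      also have "\<dots> \<le> 4 * ((K * norming_prod m) * at_origin n)"
        using K(3)[of m n] m mn u by (intro mult_left_mono mult_right_mono) auto
      finally have "norming_prod m * at_origin m \<le> norming_prod m * (4 * K * at_origin n)" by (simp add: algebra_simps)
      then show "at_origin m \<le> 4 * K * at_origin n" using norming_prod_pos[OF mn(4)] by simp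
    qed
  qed
  have nonneg: "0 \<le> return_at n" "0 \<le> at_origin n" for n by (auto simp: return_at_def at_origin_def)
  show ?thesis
    by (rule renewal_ratio[OF renewal_equation at_origin_0 return_at_0 nonneg return_at_sums
          renewal_summable[OF renewal_equation at_origin_0 nonneg return_at_sums assms(2)] pos ratio doubling])
qed

end

theorem theorem4:
  fixes M :: "'a measure" and N :: "'b measure"
    and \<xi> :: "nat \<Rightarrow> 'a \<Rightarrow> int ^ 'd"
    and c :: "nat \<Rightarrow> real ^ 'd"
    and Y :: "'b \<Rightarrow> real ^ 'd"
    and g :: "real ^ 'd \<Rightarrow> real"
    and C :: "nat \<Rightarrow> real" and p :: real
  assumes "prob_space M" and "prob_space N"
    and "iid_steps M \<xi>"
    and "aperiodic M \<xi>"
    and "transient M \<xi>"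
    and "Y \<in> borel_measurable N"
    and "asymptotically_stable M \<xi> c N Y"
    and "distributed N lborel Y (\<lambda>y. ennreal (g y))"
    and "\<And>y. g y \<ge> 0" and "continuous_on UNIV g"
    and "g 0 \<noteq> 0"
    and "\<And>n. C n = (\<Prod>r\<in>UNIV. c n $ r)"
    and "p = return_prob M \<xi>"
  shows "(\<lambda>n. \<P>(\<omega> in M. return_time \<xi> \<omega> = enat n))
           \<sim>[sequentially] (\<lambda>n. (1 - p)\<^sup>2 * \<P>(\<omega> in M. walk \<xi> n \<omega> = 0)) \<and>
         (\<lambda>n. (1 - p)\<^sup>2 * \<P>(\<omega> in M. walk \<xi> n \<omega> = 0))
           \<sim>[sequentially] (\<lambda>n. (1 - p)\<^sup>2 * g 0 / C n)"
proof -
  have p: "p < 1" using assms(5,13) by (simp add: transient_def)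
  interpret iid_walk M \<xi>
    by (intro iid_walk.intro iid_walk_axioms.intro assms(1,3))
  interpret stable_walk M \<xi> N c Y g
    using assms by (intro stable_walk.intro stable_walk_axioms.intro iid_walk_axioms)
      (auto simp: asymptotically_stable_def)
  have C: "C = norming_prod"
    using assms(12) by (auto simp: norming_prod_def)
  have first: "(\<lambda>n. return_at n / ((1 - p)\<^sup>2 * at_origin n)) \<longlonglongrightarrow> 1"
  proof -
    have "(\<lambda>n. return_at n / at_origin n / (1 - p)\<^sup>2) \<longlonglongrightarrow> (1 - p)\<^sup>2 / (1 - p)\<^sup>2"
      using first_return_asymptotics assms(11,13) p by (intro tendsto_divide tendsto_const) auto
    then show ?thesis using p by (simp add: mult.commute)
  qed
  have second: "(\<lambda>n. ((1 - p)\<^sup>2 * at_origin n) / ((1 - p)\<^sup>2 * g 0 / C n)) \<longlonglongrightarrow> 1"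
  proof -
    have "(\<lambda>n. C n * at_origin n / g 0) \<longlonglongrightarrow> g 0 / g 0"
      unfolding C using local_limit assms(11) by (intro tendsto_divide tendsto_const)
    then show ?thesis using p assms(11) by (simp add: mult.commute)
  qed
  show ?thesis
    using asymp_equivI'[OF first] asymp_equivI'[OF second]
    unfolding return_at_def at_origin_def by blast
qed

end
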